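(* Let $R$ be an integrally closed domain. The following assertions are equivalent: (1) $R$ is a strongly discrete Boole regular domain; (2) $R$ is a strongly discrete Bézout domain of finite character; (3) $R$ is a strongly stable domain.
   Context: All rings are integral domains (commutative with identity). Let $R$ be a domain with quotient field $K$. - The class semigroup $S(R)$ is the semigroup (under multiplication) of nonzero fractional ideals of $R$ modulo its subsemigroup of nonzero principal fractional ideals (so $I$ and $J$ have the same class iff $I=cJ$ for some $0\ne c\in K$). $R$ is Boole regular if $S(R)$ is a Boolean semigroup, i.e. $x^2=x$ for all $x\in S(R)$; equivalently, for every nonzero fractional ideal $I$ of $R$ there is $0\ne c\in K$ with $I^2=cI$. - $R$ is strongly discrete if it has no nonzero idempotent prime ideals, i.e. $P^2\subsetneq P$ for every nonzero prime ideal $P$ of $R$. - $R$ is of finite character if each proper nonzero ideal of $R$ is contained in only finitely many maximal ideals of $R$. - A Bézout domain is a domain in which every finitely generated ideal is principal. - $R$ is strongly stable if each nonzero ideal $I$ of $R$ is principal in its endomorphism ring $(I:I)=\{x\in K\mid xI\subseteq I\}$, i.e. $I=c(I:I)$ for some $c\in I$. *)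

theory Defs
  imports "HOL-Algebra.Algebraic_Closure_Type" "HOL-Algebra.Ideal_Product"
begin

text \<open>
  A domain is given as a subset R of its quotient field, which is a type \<^typ>\<open>'k\<close> of class
  \<open>field\<close>.  The HOL-Algebra notions (ideals, primes, products of ideals) are applied to the
  field and to R through \<^const>\<open>ring_of_type_algebra\<close>, so their operations are those of \<^typ>\<open>'k\<close>.
\<close>

abbreviation quot_field :: "'k::field ring"
  where "quot_field \<equiv> ring_of_type_algebra"

abbreviation as_ring :: "'k::field set \<Rightarrow> 'k ring"
  where "as_ring R \<equiv> ring_of_type_algebra\<lparr>carrier := R\<rparr>"

definition domain_with_quot_field :: "'k::field set \<Rightarrow> bool"
  where "domain_with_quot_field R \<longleftrightarrow>
    subdomain R quot_field \<and> (\<forall>x. \<exists>a\<in>R. \<exists>b\<in>R. b \<noteq> 0 \<and> x = a / b)"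

definition integral_over :: "'k::field set \<Rightarrow> 'k \<Rightarrow> bool"
  where "integral_over R x \<longleftrightarrow>
    (\<exists>p. lead_coeff p = 1 \<and> (\<forall>i. Polynomial.coeff p i \<in> R) \<and> poly p x = 0)"

definition integrally_closed :: "'k::field set \<Rightarrow> bool"
  where "integrally_closed R \<longleftrightarrow> (\<forall>x. integral_over R x \<longrightarrow> x \<in> R)"

definition fractional_ideal :: "'k::field set \<Rightarrow> 'k set \<Rightarrow> bool"
  where "fractional_ideal R I \<longleftrightarrow>
    additive_subgroup I quot_field \<and> (\<forall>r\<in>R. \<forall>x\<in>I. r * x \<in> I) \<and>
    (\<exists>d\<in>R. d \<noteq> 0 \<and> (\<forall>x\<in>I. d * x \<in> R))"

definition nonzero_fractional_ideals :: "'k::field set \<Rightarrow> 'k set set"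
  where "nonzero_fractional_ideals R = {I. fractional_ideal R I \<and> I \<noteq> {0}}"

text \<open>The product of fractional ideals: all finite sums of products, formed in the field.\<close>

abbreviation frac_prod :: "'k::field set \<Rightarrow> 'k set \<Rightarrow> 'k set"
  where "frac_prod I J \<equiv> ideal_prod quot_field I J"

definition same_class :: "'k::field set \<Rightarrow> ('k set \<times> 'k set) set"
  where "same_class R = {(I, J). I \<in> nonzero_fractional_ideals R \<and>
    J \<in> nonzero_fractional_ideals R \<and> (\<exists>c. c \<noteq> 0 \<and> I = (*) c ` J)}"

text \<open>
  The class semigroup.  The product of two classes is the class of the product of any
  representatives; \<open>class_mult_class\<close> below shows that this is well defined.
\<close>

definition class_carrier :: "'k::field set \<Rightarrow> 'k set set set"
  where "class_carrier R = nonzero_fractional_ideals R // same_class R"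

definition class_mult :: "'k::field set \<Rightarrow> 'k set set \<Rightarrow> 'k set set \<Rightarrow> 'k set set"
  where "class_mult R C D = {L. \<exists>I\<in>C. \<exists>J\<in>D. (frac_prod I J, L) \<in> same_class R}"

definition Boole_regular :: "'k::field set \<Rightarrow> bool"
  where "Boole_regular R \<longleftrightarrow> (\<forall>C\<in>class_carrier R. class_mult R C C = C)"

definition strongly_discrete :: "'k::field set \<Rightarrow> bool"
  where "strongly_discrete R \<longleftrightarrow>
    (\<forall>P. primeideal P (as_ring R) \<and> P \<noteq> {0} \<longrightarrow> ideal_prod (as_ring R) P P \<subset> P)"

definition finite_character :: "'k::field set \<Rightarrow> bool"
  where "finite_character R \<longleftrightarrow>
    (\<forall>I. ideal I (as_ring R) \<and> I \<noteq> {0} \<and> I \<noteq> R \<longrightarrow>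
      finite {M. maximalideal M (as_ring R) \<and> I \<subseteq> M})"

definition Bezout :: "'k::field set \<Rightarrow> bool"
  where "Bezout R \<longleftrightarrow>
    (\<forall>S. finite S \<and> S \<subseteq> R \<longrightarrow> principalideal (Idl\<^bsub>as_ring R\<^esub> S) (as_ring R))"

definition endo_ring :: "'k::field set \<Rightarrow> 'k set"
  where "endo_ring I = {x. \<forall>y\<in>I. x * y \<in> I}"

definition strongly_stable :: "'k::field set \<Rightarrow> bool"
  where "strongly_stable R \<longleftrightarrow>
    (\<forall>I. ideal I (as_ring R) \<and> I \<noteq> {0} \<longrightarrow> (\<exists>c\<in>I. I = (*) c ` endo_ring I))"

lemma additive_subgroup_iff:
  "additive_subgroup I (quot_field :: 'k::field ring) \<longleftrightarrow>
    0 \<in> I \<and> (\<forall>x\<in>I. \<forall>y\<in>I. x + y \<in> I) \<and> (\<forall>x\<in>I. - x \<in> I)"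
proof -
  interpret K: ring "quot_field :: 'k ring" by (rule ring_from_type_algebra)
  have minv: "inv\<^bsub>add_monoid quot_field\<^esub> x = - x" for x :: 'k
  proof -
    have "\<ominus>\<^bsub>quot_field\<^esub> x = - x"
      by (rule K.minus_equality) (simp_all add: ring_of_type_algebra_def)
    then show ?thesis by (simp add: a_inv_def)
  qed
  show ?thesis
    unfolding additive_subgroup_def subgroup_def minv
    by (auto simp: ring_of_type_algebra_def)
qed

lemma equiv_same_class: "equiv (nonzero_fractional_ideals R) (same_class R)"
proof (rule equivI)
  show "same_class R \<subseteq> nonzero_fractional_ideals R \<times> nonzero_fractional_ideals R"
    by (auto simp: same_class_def)
  show "refl_on (nonzero_fractional_ideals R) (same_class R)"
    by (auto simp: refl_on_def same_class_def intro!: exI[of _ 1])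
  show "sym (same_class R)"
  proof (rule symI)
    fix I J assume "(I, J) \<in> same_class R"
    then obtain c where c: "I \<in> nonzero_fractional_ideals R" "J \<in> nonzero_fractional_ideals R"
      "c \<noteq> 0" "I = (*) c ` J" by (auto simp: same_class_def)
    then have "J = (*) (inverse c) ` I" by (simp add: image_image mult.assoc [symmetric])
    moreover have "inverse c \<noteq> 0" using c by simp
    ultimately show "(J, I) \<in> same_class R" unfolding same_class_def using c(1,2) by blast
  qed
  show "trans (same_class R)"
  proof (rule transI)
    fix I J L assume "(I, J) \<in> same_class R" "(J, L) \<in> same_class R"
    then obtain c d where c: "I \<in> nonzero_fractional_ideals R" "L \<in> nonzero_fractional_ideals R"
      "c \<noteq> 0" "d \<noteq> 0" "I = (*) c ` J" "J = (*) d ` L" by (auto simp: same_class_def)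
    then have "I = (*) (c * d) ` L" by (auto simp: image_image mult.assoc)
    moreover have "c * d \<noteq> 0" using c by simp
    ultimately show "(I, L) \<in> same_class R" unfolding same_class_def using c(1,2) by blast
  qed
qed

lemma frac_prod_induct [consumes 1, case_names prod sum]:
  assumes "s \<in> frac_prod I J"
    and "\<And>i j. i \<in> I \<Longrightarrow> j \<in> J \<Longrightarrow> P (i * j)"
    and "\<And>x y. x \<in> frac_prod I J \<Longrightarrow> y \<in> frac_prod I J \<Longrightarrow> P x \<Longrightarrow> P y \<Longrightarrow> P (x + y)"
  shows "P (s :: 'k::field)"
  using assms(1)
  by (induction rule: ideal_prod.induct) (auto simp: ring_of_type_algebra_def intro: assms(2,3)
      [unfolded ring_of_type_algebra_def])

lemma frac_prod_mult: "i \<in> I \<Longrightarrow> j \<in> J \<Longrightarrow> i * j \<in> frac_prod I (J :: 'k::field set)"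
  using ideal_prod.prod[of i I j J quot_field] by (simp add: ring_of_type_algebra_def)

lemma frac_prod_add:
  "x \<in> frac_prod I J \<Longrightarrow> y \<in> frac_prod I J \<Longrightarrow> x + y \<in> frac_prod I (J :: 'k::field set)"
  using ideal_prod.sum[of x quot_field I J y] by (simp add: ring_of_type_algebra_def)

lemma frac_prod_scale:
  fixes I J :: "'k::field set"
  shows "frac_prod ((*) c ` I) ((*) d ` J) = (*) (c * d) ` frac_prod I J"
proof (intro equalityI subsetI)
  fix s assume "s \<in> frac_prod ((*) c ` I) ((*) d ` J)"
  then show "s \<in> (*) (c * d) ` frac_prod I J"
  proof (induction rule: frac_prod_induct)
    case (prod i j)
    then obtain a b where "a \<in> I" "b \<in> J" "i = c * a" "j = d * b" by auto
    then show ?case using frac_prod_mult[of a I b J] by (auto intro!: image_eqI[of _ _ "a * b"])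
  next
    case (sum x y)
    then obtain u v where "x = c * d * u" "y = c * d * v" "u \<in> frac_prod I J" "v \<in> frac_prod I J"
      by auto
    then show ?case using frac_prod_add[of u I J v]
      by (auto simp: algebra_simps intro!: image_eqI[of _ _ "u + v"])
  qed
next
  fix s assume "s \<in> (*) (c * d) ` frac_prod I J"
  then obtain t where t: "t \<in> frac_prod I J" and s: "s = c * d * t" by auto
  from t have "c * d * t \<in> frac_prod ((*) c ` I) ((*) d ` J)"
  proof (induction rule: frac_prod_induct)
    case (prod i j)
    then have "(c * i) * (d * j) \<in> frac_prod ((*) c ` I) ((*) d ` J)"
      by (intro frac_prod_mult) auto
    then show ?case by (simp add: algebra_simps)
  next
    case (sum x y)
    then show ?case using frac_prod_add by (simp add: distrib_left)
  qed
  with s show "s \<in> frac_prod ((*) c ` I) ((*) d ` J)" by simp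
qed

lemma frac_prod_nonzero_fractional:
  fixes R :: "'k::field set"
  assumes R: "domain_with_quot_field R"
    and I: "I \<in> nonzero_fractional_ideals R" and J: "J \<in> nonzero_fractional_ideals R"
  shows "frac_prod I J \<in> nonzero_fractional_ideals R"
proof -
  note fi = I[unfolded nonzero_fractional_ideals_def fractional_ideal_def additive_subgroup_iff,
      simplified]
  note fj = J[unfolded nonzero_fractional_ideals_def fractional_ideal_def additive_subgroup_iff,
      simplified]
  interpret S: subdomain R "quot_field :: 'k ring"
    using R by (simp add: domain_with_quot_field_def)
  have Rm: "a * b \<in> R" if "a \<in> R" "b \<in> R" for a b
    using S.m_closed[OF that] by (simp add: ring_of_type_algebra_def)
  have Ra: "a + b \<in> R" if "a \<in> R" "b \<in> R" for a b
    using S.subgroup_axioms that by (auto simp: subgroup_def ring_of_type_algebra_def)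
  have neg: "- s \<in> frac_prod I J" if "s \<in> frac_prod I J" for s using that
  proof (induction rule: frac_prod_induct)
    case (prod i j) then show ?case using frac_prod_mult[of "- i" I j J] fi by auto
  next
    case (sum x y) then show ?case using frac_prod_add[of "- x" I J "- y"] by auto
  qed
  have smul: "r * s \<in> frac_prod I J" if "r \<in> R" "s \<in> frac_prod I J" for r s using that(2)
  proof (induction rule: frac_prod_induct)
    case (prod i j)
    then show ?case using frac_prod_mult[of "r * i" I j J] fi that by (auto simp: mult.assoc)
  next
    case (sum x y)
    then show ?case using frac_prod_add[of "r * x" I J "r * y"] by (auto simp: distrib_left)
  qed
  have zero: "0 \<in> frac_prod I J" using frac_prod_mult[of 0 I 0 J] fi fj by auto
  from fi obtain c where c: "c \<in> R" "c \<noteq> 0" "\<And>x. x \<in> I \<Longrightarrow> c * x \<in> R" by metis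
  from fj obtain d where d: "d \<in> R" "d \<noteq> 0" "\<And>x. x \<in> J \<Longrightarrow> d * x \<in> R" by metis
  note cd = c d
  have den: "(c * d) * s \<in> R" if "s \<in> frac_prod I J" for s using that
  proof (induction rule: frac_prod_induct)
    case (prod i j)
    then have "(c * i) * (d * j) \<in> R" using Rm[OF c(3) d(3)] by blast
    then show ?case by (simp add: algebra_simps)
  next
    case (sum x y) then show ?case using Ra by (simp add: distrib_left)
  qed
  obtain i j where ij: "i \<in> I" "i \<noteq> 0" "j \<in> J" "j \<noteq> 0" using fi fj by auto
  then have "i * j \<in> frac_prod I J" "i * j \<noteq> 0" by (simp_all add: frac_prod_mult)
  then have nz: "frac_prod I J \<noteq> {0}" by (metis singletonD)
  have "c * d \<in> R" "c * d \<noteq> 0" using c(1,2) d(1,2) Rm by simp_all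
  then have "\<exists>e\<in>R. e \<noteq> 0 \<and> (\<forall>s\<in>frac_prod I J. e * s \<in> R)" using den by blast
  moreover have "\<forall>s\<in>frac_prod I J. \<forall>t\<in>frac_prod I J. s + t \<in> frac_prod I J"
    using frac_prod_add by blast
  ultimately show ?thesis
    unfolding nonzero_fractional_ideals_def fractional_ideal_def additive_subgroup_iff
    using zero neg smul nz by simp
qed

lemma class_mult_class:
  fixes R :: "'k::field set"
  assumes R: "domain_with_quot_field R"
    and I: "I \<in> nonzero_fractional_ideals R" and J: "J \<in> nonzero_fractional_ideals R"
  shows "class_mult R (same_class R `` {I}) (same_class R `` {J}) = same_class R `` {frac_prod I J}"
proof -
  have eq: "same_class R `` {frac_prod I' J'} = same_class R `` {frac_prod I J}"
    if *: "I' \<in> same_class R `` {I}" "J' \<in> same_class R `` {J}" for I' J'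
  proof -
    obtain c d where cd: "c \<noteq> 0" "d \<noteq> 0" "I = (*) c ` I'" "J = (*) d ` J'"
      and mem: "I' \<in> nonzero_fractional_ideals R" "J' \<in> nonzero_fractional_ideals R"
      using * by (auto simp: same_class_def)
    have "(frac_prod I J, frac_prod I' J') \<in> same_class R"
      using frac_prod_nonzero_fractional[OF R I J] frac_prod_nonzero_fractional[OF R mem]
        frac_prod_scale[of c I' d J'] cd
      by (auto simp: same_class_def intro!: exI[of _ "c * d"])
    then show ?thesis using equiv_class_eq[OF equiv_same_class] by metis
  qed
  have "I \<in> same_class R `` {I}" "J \<in> same_class R `` {J}"
    using I J equiv_class_self[OF equiv_same_class] by auto
  then show ?thesis unfolding class_mult_def using eq by blast
qed

lemma Boole_regular_iff:
  assumes "domain_with_quot_field R"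
  shows "Boole_regular R \<longleftrightarrow>
    (\<forall>I\<in>nonzero_fractional_ideals R. \<exists>c. c \<noteq> 0 \<and> frac_prod I I = (*) c ` I)"
proof -
  have "class_mult R (same_class R `` {I}) (same_class R `` {I}) = same_class R `` {I} \<longleftrightarrow>
      (\<exists>c. c \<noteq> 0 \<and> frac_prod I I = (*) c ` I)" if I: "I \<in> nonzero_fractional_ideals R" for I
  proof -
    note II = frac_prod_nonzero_fractional[OF assms I I]
    have "class_mult R (same_class R `` {I}) (same_class R `` {I}) = same_class R `` {I} \<longleftrightarrow>
        (frac_prod I I, I) \<in> same_class R"
      unfolding class_mult_class[OF assms I I]
      using eq_equiv_class_iff[OF equiv_same_class II I] by simp
    then show ?thesis using I II by (simp add: same_class_def)
  qed
  then show ?thesis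
    unfolding Boole_regular_def class_carrier_def by (simp add: quotient_def)
qed

end

theory Submission
  imports Defs
begin

text \<open>
  Strong stability is the central condition: it is shown to be equivalent to each of the other two.
  Write \<open>E\<close> for the endomorphism ring of an ideal \<open>I\<close>.

  Strong stability yields both parts of the first condition: if \<open>I = c E\<close> then
  \<open>I I = c c E = c I\<close>, which is Boole regularity; and a prime \<open>P = c E\<close> with \<open>P P = P\<close> would satisfy \<open>c P = P\<close>, so \<open>c \<in> P\<close> would give \<open>1 \<in> P\<close>.

  Conversely, let \<open>R\<close> be strongly discrete and Boole regular.  If \<open>I I = c I\<close>, then
  \<open>J = I / c\<close> is idempotent.  When \<open>I\<close> is generated by two elements,
  the determinant trick shows that \<open>J\<close> consists of integral elements and contains \<open>1\<close>, so \<open>J = R\<close>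
  and \<open>I = c R\<close>; here integral closure enters, and makes \<open>R\<close> Bezout
  (\<open>Boole_regular_imp_Bezout\<close>).  For arbitrary \<open>I\<close> it suffices that \<open>1 \<in> J\<close>, for then \<open>J = E\<close>.
  If \<open>1 \<notin> J\<close>, some localization \<open>J\<^sub>M\<close> is a proper nonzero idempotent ideal of the
  valuation ring \<open>R\<^sub>M\<close>.  Such an ideal is prime, and its trace on \<open>R\<close> is an idempotent prime
  (\<open>idempotent_one_mem\<close>), which strong discreteness forbids.

  Now let \<open>R\<close> be a strongly discrete Bezout domain of finite character.  Strong
  discreteness makes every nonzero ideal of the valuation ring \<open>R\<^sub>M\<close> principal over its own endomorphism ring (\<open>locally_principal_square\<close>).  By finite character only finitely many \<open>M\<close>
  matter for a given \<open>I\<close>, so one element \<open>d\<close> of \<open>I\<close>, a common divisor of finitely many elements of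
  \<open>I\<close>, serves for all \<open>M\<close> at once, and then \<open>I = d E\<close>
  (\<open>finite_character_imp_strongly_stable\<close>).

  It remains to derive finite character from strong stability.  If \<open>x \<noteq> 0\<close> lay in infinitely many maximal
  ideals, \<open>x\<close> would have an infinite sequence \<open>f\<close> of pairwise comaximal nonunit divisors
  (\<open>infinite_comaximal_divisors\<close>).  The ideal generated by all quotients
  \<open>x / (f 0 \<cdots> f n)\<close> is locally principal, hence its endomorphism ring is \<open>R\<close>, and strong stability makes
  it principal.  But it is the union of a strictly increasing chain of ideals, a contradiction
  (\<open>no_infinite_comaximal_divisors\<close>).

  No localization is ever formed.  An assertion in \<open>R\<^sub>M\<close> is expressed by an element \<open>s \<in> R\<close>
  outside \<open>M\<close> by which one has to multiply, and valuation rings appear only through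
  \<open>locally_comparable\<close>.
\<close>

section \<open>Submodules of the quotient field\<close>

locale domain_in_field =
  fixes R :: "'k::field set"
  assumes domain_with_quot_field: "domain_with_quot_field R"
begin

lemma subdomain: "subdomain R quot_field"
  using domain_with_quot_field by (simp add: domain_with_quot_field_def)

lemma additive: "additive_subgroup R quot_field"
proof -
  interpret subdomain R "quot_field :: 'k ring" by (rule subdomain)
  show ?thesis by (rule additive_subgroup.intro) (rule subgroup_axioms)
qed

lemma zero_mem [simp, intro]: "0 \<in> R"
  and add_mem [intro]: "a \<in> R \<Longrightarrow> b \<in> R \<Longrightarrow> a + b \<in> R"
  and uminus_mem [intro]: "a \<in> R \<Longrightarrow> - a \<in> R"
  using additive by (auto simp: additive_subgroup_iff)

lemma diff_mem [intro]: "a \<in> R \<Longrightarrow> b \<in> R \<Longrightarrow> a - b \<in> R"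
  using add_mem[of a "- b"] by auto

lemma one_mem [simp, intro]: "1 \<in> R"
proof -
  interpret subdomain R "quot_field :: 'k ring" by (rule subdomain)
  show ?thesis using one_closed by (simp add: ring_of_type_algebra_def)
qed

lemma mult_mem [intro]: "a \<in> R \<Longrightarrow> b \<in> R \<Longrightarrow> a * b \<in> R"
proof -
  interpret subdomain R "quot_field :: 'k ring" by (rule subdomain)
  show "a \<in> R \<Longrightarrow> b \<in> R \<Longrightarrow> a * b \<in> R"
    using m_closed[of a b] by (simp add: ring_of_type_algebra_def)
qed

lemma common_denominator:
  obtains d where "d \<in> R" "d \<noteq> 0" "d * x \<in> R"
proof -
  obtain a b where "a \<in> R" "b \<in> R" "b \<noteq> 0" "x = a / b"
    using domain_with_quot_field unfolding domain_with_quot_field_def by metis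
  then show ?thesis using that[of b] by simp
qed

lemma cring_as_ring: "cring (as_ring R)"
proof -
  have "\<exists>y\<in>R. x + y = 0 \<and> y + x = 0" if "x \<in> R" for x
    using that by (intro bexI[of _ "- x"]) auto
  then show ?thesis
    by unfold_locales
      (auto simp: ring_of_type_algebra_def algebra_simps Units_def)
qed

text \<open>
  This covers ideals of \<open>R\<close>, fractional ideals and overrings alike, so that the inverse scalings
  \<open>I / c\<close> can be handled without a bound on denominators.
\<close>

definition submodule :: "'k set \<Rightarrow> bool"
  where "submodule S \<longleftrightarrow>
    0 \<in> S \<and> (\<forall>x\<in>S. \<forall>y\<in>S. x + y \<in> S) \<and> (\<forall>r\<in>R. \<forall>x\<in>S. r * x \<in> S)"

lemma submodule_zero: "submodule S \<Longrightarrow> 0 \<in> S"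
  and submodule_add: "submodule S \<Longrightarrow> x \<in> S \<Longrightarrow> y \<in> S \<Longrightarrow> x + y \<in> S"
  and submodule_mult: "submodule S \<Longrightarrow> r \<in> R \<Longrightarrow> x \<in> S \<Longrightarrow> r * x \<in> S"
  by (auto simp: submodule_def)

lemma submodule_uminus: "submodule S \<Longrightarrow> x \<in> S \<Longrightarrow> - x \<in> S"
  using submodule_mult[of S "- 1" x] by auto

lemma submodule_add_scaled:
  assumes "submodule S" "s \<in> R" "t \<in> R" "s * x \<in> S" "t * y \<in> S"
  shows "s * t * (x + y) \<in> S"
proof -
  have "s * t * (x + y) = t * (s * x) + s * (t * y)" by (simp add: algebra_simps)
  also have "\<dots> \<in> S"
    using submodule_add submodule_mult assms by metis
  finally show ?thesis .
qed

lemma submodule_R: "submodule R"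
  by (auto simp: submodule_def)

lemma submodule_scale:
  assumes "submodule S" shows "submodule ((*) c ` S)"
proof -
  have "r * (c * x) \<in> (*) c ` S" if "r \<in> R" "x \<in> S" for r x
    using submodule_mult[OF assms that] by (auto intro!: image_eqI[of _ _ "r * x"])
  moreover have "c * x + c * y \<in> (*) c ` S" if "x \<in> S" "y \<in> S" for x y
    using submodule_add[OF assms that] by (auto intro!: image_eqI[of _ _ "x + y"] simp: distrib_left)
  moreover have "0 \<in> (*) c ` S"
    using submodule_zero[OF assms] by (auto intro!: image_eqI[of _ _ 0])
  ultimately show ?thesis by (auto simp: submodule_def)
qed

lemma submodule_adjoin:
  assumes "submodule S" shows "submodule {m + r * x |m r. m \<in> S \<and> r \<in> R}"
  unfolding submodule_def
proof (intro conjI ballI)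
  let ?J = "{m + r * x |m r. m \<in> S \<and> r \<in> R}"
  show "0 \<in> ?J" using submodule_zero[OF assms] by force
  fix u assume "u \<in> ?J"
  then obtain m r where u: "u = m + r * x" "m \<in> S" "r \<in> R" by blast
  show "u + v \<in> ?J" if v: "v \<in> ?J" for v
  proof -
    obtain n s where v: "v = n + s * x" "n \<in> S" "s \<in> R" using v by blast
    have "u + v = (m + n) + (r + s) * x" using u v by (simp add: algebra_simps)
    moreover have "m + n \<in> S" "r + s \<in> R" using u v submodule_add[OF assms] by auto
    ultimately show ?thesis by blast
  qed
  show "t * u \<in> ?J" if "t \<in> R" for t
  proof -
    have "t * u = t * m + (t * r) * x" using u by (simp add: distrib_left mult.assoc)
    moreover have "t * m \<in> S" "t * r \<in> R" using u that submodule_mult[OF assms] by auto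
    ultimately show ?thesis by blast
  qed
qed

lemma submodule_prod:
  assumes "submodule S" "submodule T" shows "submodule (frac_prod S T)"
proof -
  have "0 \<in> frac_prod S T"
    using frac_prod_mult[OF submodule_zero[OF assms(1)] submodule_zero[OF assms(2)]] by simp
  moreover have "r * x \<in> frac_prod S T" if r: "r \<in> R" and x: "x \<in> frac_prod S T" for r x
    using x
  proof (induction rule: frac_prod_induct)
    case (prod i j)
    then show ?case
      using frac_prod_mult[OF submodule_mult[OF assms(1) r]] by (simp add: mult.assoc[symmetric])
  next
    case (sum x y)
    then show ?case by (simp add: distrib_left frac_prod_add)
  qed
  ultimately show ?thesis by (auto simp: submodule_def frac_prod_add)
qed

lemma frac_prod_subset:
  assumes "submodule U" "\<And>i j. i \<in> S \<Longrightarrow> j \<in> T \<Longrightarrow> i * j \<in> U"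
  shows "frac_prod S T \<subseteq> U"
proof
  fix x assume "x \<in> frac_prod S T"
  then show "x \<in> U"
    by (induction rule: frac_prod_induct) (auto intro: assms submodule_add)
qed

lemma ideal_iff: "ideal I (as_ring R) \<longleftrightarrow> submodule I \<and> I \<subseteq> R"
proof
  assume "ideal I (as_ring R)"
  then interpret ideal I "as_ring R" .
  have "0 \<in> I" using additive_subgroup.zero_closed[OF is_additive_subgroup] by (simp add: ring_of_type_algebra_def)
  moreover have "x + y \<in> I" if "x \<in> I" "y \<in> I" for x y
    using additive_subgroup.a_closed[OF is_additive_subgroup that] by (simp add: ring_of_type_algebra_def)
  moreover have "r * x \<in> I" if "r \<in> R" "x \<in> I" for r x
    using I_l_closed[of x r] that by (simp add: ring_of_type_algebra_def)
  moreover have "I \<subseteq> R" using a_subset by simp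
  ultimately show "submodule I \<and> I \<subseteq> R" by (simp add: submodule_def)
next
  assume I: "submodule I \<and> I \<subseteq> R"
  interpret C: cring "as_ring R" by (rule cring_as_ring)
  have minv: "inv\<^bsub>add_monoid (as_ring R)\<^esub> x = - x" if "x \<in> R" for x
  proof -
    have "\<ominus>\<^bsub>as_ring R\<^esub> x = - x"
      using that by (intro C.minus_equality) (auto simp: ring_of_type_algebra_def)
    then show ?thesis by (simp add: a_inv_def)
  qed
  have "subgroup I (add_monoid (as_ring R))"
  proof
    show "I \<subseteq> carrier (add_monoid (as_ring R))" using I by simp
    show "x \<otimes>\<^bsub>add_monoid (as_ring R)\<^esub> y \<in> I" if "x \<in> I" "y \<in> I" for x y
      using I that by (simp add: submodule_def ring_of_type_algebra_def)
    show "\<one>\<^bsub>add_monoid (as_ring R)\<^esub> \<in> I"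
      using I by (simp add: submodule_def ring_of_type_algebra_def)
    show "inv\<^bsub>add_monoid (as_ring R)\<^esub> x \<in> I" if "x \<in> I" for x
      proof -
      have "- x \<in> I" "x \<in> R" using I that submodule_uminus by auto
      then show ?thesis by (subst minv)
    qed
  qed
  moreover have "r * x \<in> I" "x * r \<in> I" if "x \<in> I" "r \<in> R" for r x
    using that I submodule_mult[of I r x] by (auto simp: mult.commute)
  ultimately show "ideal I (as_ring R)"
    using C.ring_axioms by (intro idealI) (simp_all add: ring_of_type_algebra_def)
qed

lemma ideal_submodule: "ideal I (as_ring R) \<Longrightarrow> submodule I"
  and ideal_subset: "ideal I (as_ring R) \<Longrightarrow> I \<subseteq> R"
  by (simp_all add: ideal_iff)

lemma fractional_ideal_iff:
  "fractional_ideal R I \<longleftrightarrow> submodule I \<and> (\<exists>d\<in>R. d \<noteq> 0 \<and> (\<forall>x\<in>I. d * x \<in> R))"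
proof -
  have "- x \<in> I" if "\<forall>r\<in>R. \<forall>x\<in>I. r * x \<in> I" "x \<in> I" for x
    using that(1)[rule_format, of "- 1" x] that(2) by auto
  then show ?thesis
    unfolding fractional_ideal_def additive_subgroup_iff submodule_def by blast
qed

lemma ideal_prod_eq: "ideal_prod (as_ring R) I J = frac_prod I J"
proof (intro equalityI subsetI)
  fix x assume "x \<in> ideal_prod (as_ring R) I J"
  then show "x \<in> frac_prod I J"
  proof induction
    case (prod i j)
    then show ?case using frac_prod_mult by (simp add: ring_of_type_algebra_def)
  next
    case (sum x y)
    then show ?case using frac_prod_add[of x I J y] by (simp add: ring_of_type_algebra_def)
  qed
next
  fix x assume "x \<in> frac_prod I J"
  then show "x \<in> ideal_prod (as_ring R) I J"
  proof (induction rule: frac_prod_induct)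
    case (prod i j)
    then show ?case
      using ideal_prod.prod[of i I j J "as_ring R"] by (simp add: ring_of_type_algebra_def)
  next
    case (sum x y)
    then show ?case
      using ideal_prod.sum[of x "as_ring R" I J y] by (simp add: ring_of_type_algebra_def)
  qed
qed

lemma primeideal_iff:
  "primeideal P (as_ring R) \<longleftrightarrow>
    submodule P \<and> P \<subseteq> R \<and> 1 \<notin> P \<and> (\<forall>a\<in>R. \<forall>b\<in>R. a * b \<in> P \<longrightarrow> a \<in> P \<or> b \<in> P)"
proof -
  have "(R \<noteq> P) = (1 \<notin> P)" if "submodule P" "P \<subseteq> R"
    using submodule_mult[OF that(1), of _ 1] that(2) by auto
  then show ?thesis
    using cring_as_ring
    unfolding primeideal_def primeideal_axioms_def ideal_iff
    by (auto simp: ring_of_type_algebra_def)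
qed

lemma maximal_prime: "maximalideal M (as_ring R) \<Longrightarrow> primeideal M (as_ring R)"
  by (rule cring.maximalideal_prime[OF cring_as_ring])

lemma maximal_comaximal:
  assumes "maximalideal M (as_ring R)" and x: "x \<in> R" "x \<notin> M"
  obtains m r where "m \<in> M" "r \<in> R" "m + r * x = 1"
proof -
  interpret maximalideal M "as_ring R" by fact
  have M: "submodule M" "M \<subseteq> R" using is_ideal by (simp_all add: ideal_iff)
  define J where "J = {m + r * x |m r. m \<in> M \<and> r \<in> R}"
  have J: "ideal J (as_ring R)"
    unfolding ideal_iff J_def using submodule_adjoin[OF M(1)] M x by auto
  have mem: "m + r * x \<in> J" if "m \<in> M" "r \<in> R" for m r
    using that by (auto simp: J_def)
  have "M \<subseteq> J" using mem[of _ 0] by auto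
  moreover have "x \<in> J" using mem[of 0 1] submodule_zero[OF M(1)] by auto
  ultimately have "J = R" using I_maximal[of J] J x by (auto simp: ideal_iff)
  then have "1 \<in> J" by simp
  then obtain m r where "m \<in> M" "r \<in> R" "1 = m + r * x" unfolding J_def by blast
  then show ?thesis using that[of m r] by simp
qed

lemma exists_maximal:
  assumes I: "submodule I" "I \<subseteq> R" "1 \<notin> I"
  obtains M where "maximalideal M (as_ring R)" "I \<subseteq> M"
proof -
  define A where "A = {J. submodule J \<and> I \<subseteq> J \<and> J \<subseteq> R \<and> 1 \<notin> J}"
  have "\<exists>M\<in>A. \<forall>L\<in>A. M \<subseteq> L \<longrightarrow> L = M"
  proof (rule subset_Zorn_nonempty)
    show "A \<noteq> {}" using I by (auto simp: A_def)
    fix C assume C: "C \<noteq> {}" "subset.chain A C"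
    then have CA: "C \<subseteq> A" and ch: "\<And>L Y. L \<in> C \<Longrightarrow> Y \<in> C \<Longrightarrow> L \<subseteq> Y \<or> Y \<subseteq> L"
      by (auto simp: subset_chain_def)
    have "submodule (\<Union>C)"
      unfolding submodule_def
    proof (intro conjI ballI)
      show "0 \<in> \<Union>C" using C(1) CA submodule_zero unfolding A_def by blast
      show "u + v \<in> \<Union>C" if uv: "u \<in> \<Union>C" "v \<in> \<Union>C" for u v
      proof -
        obtain L Y where XY: "L \<in> C" "Y \<in> C" "u \<in> L" "v \<in> Y" using uv by blast
        obtain Z where "Z \<in> C" "u \<in> Z" "v \<in> Z" using ch[OF XY(1,2)] XY by blast
        then show ?thesis using CA submodule_add unfolding A_def by blast
      qed
      show "r * u \<in> \<Union>C" if "r \<in> R" "u \<in> \<Union>C" for r u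
        using that CA submodule_mult unfolding A_def by blast
    qed
    then show "\<Union>C \<in> A" using C(1) CA unfolding A_def by blast
  qed
  then obtain M where M: "M \<in> A" and max: "\<And>L. L \<in> A \<Longrightarrow> M \<subseteq> L \<Longrightarrow> L = M" by blast
  have "maximalideal M (as_ring R)"
  proof (rule maximalidealI)
    show "ideal M (as_ring R)" using M by (simp add: A_def ideal_iff)
    show "carrier (as_ring R) \<noteq> M" using M by (auto simp: A_def)
    fix J assume J: "ideal J (as_ring R)" "M \<subseteq> J" "J \<subseteq> carrier (as_ring R)"
    then have sJ: "submodule J" by (simp add: ideal_iff)
    show "J = M \<or> J = carrier (as_ring R)"
    proof (cases "1 \<in> J")
      case True
      then have "R \<subseteq> J" using submodule_mult[OF sJ, of _ 1] by auto
      then show ?thesis using J by auto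
    next
      case False
      then show ?thesis using max[of J] M J sJ by (auto simp: A_def)
    qed
  qed
  then show ?thesis using that M by (auto simp: A_def)
qed

text \<open>
  The conductor \<open>{r \<in> R. r * x \<in> S}\<close> is an ideal that no maximal ideal contains.
\<close>

lemma local_global:
  assumes S: "submodule S"
    and loc: "\<And>M. maximalideal M (as_ring R) \<Longrightarrow> \<exists>s\<in>R. s \<notin> M \<and> s * x \<in> S"
  shows "x \<in> S"
proof (rule ccontr)
  assume "x \<notin> S"
  let ?A = "{r \<in> R. r * x \<in> S}"
  have "submodule ?A"
    using S by (auto simp: submodule_def algebra_simps)
  moreover have "?A \<subseteq> R" "1 \<notin> ?A" using \<open>x \<notin> S\<close> by auto
  ultimately obtain M where "maximalideal M (as_ring R)" "?A \<subseteq> M"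
    using exists_maximal by blast
  then show False using loc by blast
qed

section \<open>Bezout domains\<close>

text \<open>
  A generator of the ideal generated by \<open>F\<close> divides every element of \<open>F\<close> and, being a linear
  combination of them, does not leave \<open>I\<close>.
\<close>

lemma ideal_finite_divisor:
  assumes "Bezout R" and I: "submodule I" "I \<subseteq> R" and F: "finite F" "F \<subseteq> I"
  obtains d where "d \<in> I" "F \<subseteq> (*) d ` R"
proof -
  interpret C: cring "as_ring R" by (rule cring_as_ring)
  have "F \<subseteq> R" using F I by blast
  then have "principalideal (Idl\<^bsub>as_ring R\<^esub> F) (as_ring R)"
    using assms(1) F by (simp add: Bezout_def)
  then obtain d where d: "d \<in> R" "Idl\<^bsub>as_ring R\<^esub> F = Idl\<^bsub>as_ring R\<^esub> {d}"
    using principalideal.generate[of "Idl\<^bsub>as_ring R\<^esub> F" "as_ring R"] by auto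
  have "Idl\<^bsub>as_ring R\<^esub> F \<subseteq> I"
    using F I by (intro C.genideal_minimal) (auto simp: ideal_iff)
  moreover have "d \<in> Idl\<^bsub>as_ring R\<^esub> {d}" using C.genideal_self[of "{d}"] d by simp
  ultimately have "d \<in> I" using d by blast
  moreover have "Idl\<^bsub>as_ring R\<^esub> {d} \<subseteq> (*) d ` R"
    using d submodule_scale[OF submodule_R, of d]
    by (intro C.genideal_minimal) (auto simp: ideal_iff intro: image_eqI[of _ _ 1])
  then have "F \<subseteq> (*) d ` R" using C.genideal_self[of F] \<open>F \<subseteq> R\<close> d by auto
  ultimately show ?thesis using that by blast
qed

text \<open>
  The cofactors of a greatest common divisor are comaximal because the divisor is itself a linear
  combination and can be cancelled.
\<close>

lemma Bezout_pair:
  assumes "Bezout R" and ab: "a \<in> R" "b \<in> R" "a \<noteq> 0 \<or> b \<noteq> 0"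
  obtains g a' b' \<alpha> \<beta> where "g \<in> R" "a' \<in> R" "b' \<in> R" "\<alpha> \<in> R" "\<beta> \<in> R" "g \<noteq> 0"
    "a = g * a'" "b = g * b'" "g = \<alpha> * a + \<beta> * b" "\<alpha> * a' + \<beta> * b' = 1"
proof -
  define I where "I = {m + r * b |m r. m \<in> (*) a ` R \<and> r \<in> R}"
  have I: "submodule I" "I \<subseteq> R"
    using submodule_adjoin[OF submodule_scale[OF submodule_R]] ab by (auto simp: I_def)
  have "a * 1 + 0 * b \<in> I" "a * 0 + 1 * b \<in> I" unfolding I_def by blast+
  then have "{a, b} \<subseteq> I" by simp
  then obtain g where g: "g \<in> I" "{a, b} \<subseteq> (*) g ` R"
    using ideal_finite_divisor[OF assms(1) I, of "{a, b}"] by auto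
  then have "a \<in> (*) g ` R" "b \<in> (*) g ` R" by auto
  then obtain a' b' where ab': "a' \<in> R" "b' \<in> R" "a = g * a'" "b = g * b'"
    by (auto elim!: imageE)
  obtain m \<beta> where \<beta>: "g = m + \<beta> * b" "m \<in> (*) a ` R" "\<beta> \<in> R"
    using g(1) unfolding I_def by blast
  then obtain \<alpha> where "\<alpha> \<in> R" "m = a * \<alpha>" by blast
  then have c: "\<alpha> \<in> R" "\<beta> \<in> R" "g = \<alpha> * a + \<beta> * b" using \<beta> by (simp_all add: mult.commute)
  have "g \<noteq> 0" using ab ab' by auto
  moreover have "g * (\<alpha> * a' + \<beta> * b') = g * 1" using c(3) ab' by (simp add: algebra_simps)
  ultimately have "\<alpha> * a' + \<beta> * b' = 1" by simp
  then show ?thesis using that[of g a' b' \<alpha> \<beta>] g I ab' c \<open>g \<noteq> 0\<close> by blast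
qed

lemma BezoutI:
  assumes pair: "\<And>a b. a \<in> R \<Longrightarrow> b \<in> R \<Longrightarrow>
      \<exists>g\<in>R. a \<in> (*) g ` R \<and> b \<in> (*) g ` R \<and> (\<exists>\<alpha>\<in>R. \<exists>\<beta>\<in>R. g = \<alpha> * a + \<beta> * b)"
  shows "Bezout R"
  unfolding Bezout_def
proof (intro allI impI, elim conjE)
  interpret C: cring "as_ring R" by (rule cring_as_ring)
  fix S assume S: "finite S" "S \<subseteq> R"
  then have "\<exists>g\<in>R. S \<subseteq> (*) g ` R \<and> (\<forall>I. submodule I \<and> S \<subseteq> I \<longrightarrow> g \<in> I)"
  proof (induction rule: finite_induct)
    case empty
    show ?case using submodule_zero by (intro bexI[of _ 0]) auto
  next
    case (insert a S)
    then obtain h where h: "h \<in> R" "S \<subseteq> (*) h ` R" "\<And>I. submodule I \<Longrightarrow> S \<subseteq> I \<Longrightarrow> h \<in> I"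
      by blast
    obtain g \<alpha> \<beta> where g: "g \<in> R" "a \<in> (*) g ` R" "h \<in> (*) g ` R" "\<alpha> \<in> R" "\<beta> \<in> R"
      "g = \<alpha> * a + \<beta> * h"
      using pair[of a h] insert.prems h by blast
    from g(3) obtain k where k: "k \<in> R" "h = g * k" by blast
    have "h * r \<in> (*) g ` R" if "r \<in> R" for r
      using k that by (auto intro!: image_eqI[of _ _ "k * r"] simp: mult.assoc)
    then have "(*) h ` R \<subseteq> (*) g ` R" by blast
    then have "insert a S \<subseteq> (*) g ` R" using g(2) h(2) by auto
    moreover have "g \<in> I" if "submodule I" "insert a S \<subseteq> I" for I
    proof -
      have "h \<in> I" "a \<in> I" using that h(3) by auto
      then show ?thesis
        unfolding g(6) using g(4,5) that(1) by (intro submodule_add submodule_mult)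
    qed
    ultimately show ?case using g(1) by blast
  qed
  then obtain g where g: "g \<in> R" "S \<subseteq> (*) g ` R" "\<And>I. submodule I \<Longrightarrow> S \<subseteq> I \<Longrightarrow> g \<in> I"
    by blast
  let ?I = "Idl\<^bsub>as_ring R\<^esub> S" and ?G = "Idl\<^bsub>as_ring R\<^esub> {g}"
  have I: "ideal ?I (as_ring R)" "S \<subseteq> ?I"
    using S C.genideal_ideal[of S] C.genideal_self[of S] by auto
  have G: "ideal ?G (as_ring R)" "g \<in> ?G"
    using g C.genideal_ideal[of "{g}"] C.genideal_self[of "{g}"] by auto
  have "S \<subseteq> ?G"
  proof
    fix y assume "y \<in> S"
    then obtain r where "r \<in> R" "y = g * r" using g by blast
    then show "y \<in> ?G"
      using submodule_mult[OF ideal_submodule[OF G(1)] \<open>r \<in> R\<close> G(2)] by (simp add: mult.commute)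
  qed
  moreover have "g \<in> ?I" using I by (intro g(3)) (auto simp: ideal_iff)
  ultimately have "?I = ?G"
    using C.genideal_minimal[OF I(1), of "{g}"] C.genideal_minimal[OF G(1), of S] by blast
  then show "principalideal ?I (as_ring R)" using I(1) g by (intro principalidealI) auto
qed

lemma prime_submodule: "primeideal P (as_ring R) \<Longrightarrow> submodule P"
  and prime_subset: "primeideal P (as_ring R) \<Longrightarrow> P \<subseteq> R"
  and prime_one_notin: "primeideal P (as_ring R) \<Longrightarrow> 1 \<notin> P"
  and prime_mult_notin:
    "primeideal P (as_ring R) \<Longrightarrow> a \<in> R \<Longrightarrow> b \<in> R \<Longrightarrow> a \<notin> P \<Longrightarrow> b \<notin> P \<Longrightarrow> a * b \<notin> P"
  by (auto simp: primeideal_iff)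

text \<open>
  This is the statement that the localization of a Bezout domain at a prime is a valuation ring,
  with denominators cleared: of two comaximal cofactors at least one lies outside \<open>P\<close>.
\<close>

lemma locally_comparable:
  assumes "Bezout R" and P: "primeideal P (as_ring R)"
  obtains (left) s r where "s \<in> R" "s \<notin> P" "r \<in> R" "s * x = r * y"
    | (right) s r where "s \<in> R" "s \<notin> P" "r \<in> R" "s * y = r * x"
proof (cases "x = 0 \<and> y = 0")
  case True
  then show ?thesis using left[of 1 1] prime_one_notin[OF P] by auto
next
  case False
  obtain d where d: "d \<in> R" "d \<noteq> 0" "d * x \<in> R" by (rule common_denominator)
  obtain e where e: "e \<in> R" "e \<noteq> 0" "e * y \<in> R" by (rule common_denominator)
  have "d * e * x \<in> R" "d * e * y \<in> R"
    using mult_mem[OF e(1) d(3)] mult_mem[OF d(1) e(3)] by (simp_all add: algebra_simps)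
  moreover have "d * e * x \<noteq> 0 \<or> d * e * y \<noteq> 0" using False d e by simp
  ultimately obtain g a b \<alpha> \<beta> where g: "a \<in> R" "b \<in> R" "\<alpha> \<in> R" "\<beta> \<in> R"
      "d * e * x = g * a" "d * e * y = g * b" "\<alpha> * a + \<beta> * b = 1"
    by (rule Bezout_pair[OF assms(1)])
  have "(d * e) * (a * y) = (d * e) * (b * x)"
  proof -
    have "(d * e) * (a * y) = a * (d * e * y)" by (simp add: mult.left_commute)
    also have "\<dots> = b * (d * e * x)" unfolding g(5,6) by (simp add: mult.left_commute)
    finally show ?thesis by (simp add: mult.left_commute)
  qed
  then have eq: "a * y = b * x" using d e by simp
  have "a \<notin> P \<or> b \<notin> P"
  proof (rule ccontr)
    assume "\<not> (a \<notin> P \<or> b \<notin> P)"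
    then have "\<alpha> * a + \<beta> * b \<in> P"
      using g(3,4) prime_submodule[OF P] by (intro submodule_add submodule_mult) auto
    then show False using g(7) prime_one_notin[OF P] by simp
  qed
  then show ?thesis using left[of b a] right[of a b] g(1,2) eq by metis
qed

text \<open>
  The square \<open>P\<^sup>2\<close> is determined by its localization at \<open>P\<close>.  At a maximal ideal \<open>M\<close>
  containing \<open>P\<close>, an element \<open>u\<close> outside \<open>P\<close> divides every element of \<open>P\<close> in \<open>R\<^sub>M\<close>, with a quotient
  again in \<open>P\<close>; thus \<open>P = u P\<close> and \<open>P\<^sup>2 = u P\<^sup>2\<close> locally, and \<open>u\<close> can be cancelled.
\<close>

lemma prime_square_cancel:
  assumes "Bezout R" and P: "primeideal P (as_ring R)"
    and x: "x \<in> P" and u: "u \<in> R" "u \<notin> P" "u * x \<in> frac_prod P P"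
  shows "x \<in> frac_prod P P"
proof (rule local_global)
  note PP = submodule_prod[OF prime_submodule[OF P] prime_submodule[OF P]]
  then show "submodule (frac_prod P P)" .
  fix M assume "maximalideal M (as_ring R)"
  then have M: "primeideal M (as_ring R)" by (rule maximal_prime)
  show "\<exists>s\<in>R. s \<notin> M \<and> s * x \<in> frac_prod P P"
  proof (cases "P \<subseteq> M")
    case False
    \<comment> \<open>Locally \<open>P\<close> is the unit ideal.\<close>
    then obtain p where "p \<in> P" "p \<notin> M" by blast
    then show ?thesis using frac_prod_mult[OF _ x, of p P] prime_subset[OF P] by blast
  next
    case True
    have divide: "\<exists>s\<in>R. s \<notin> M \<and> (\<exists>r\<in>P. s * p = u * r)" if p: "p \<in> P" for p
    proof (rule locally_comparable[OF assms(1) M, of p u])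
      fix s r assume s: "s \<in> R" "s \<notin> M" "r \<in> R" "s * p = r * u"
      then have "r * u \<in> P" using submodule_mult[OF prime_submodule[OF P]] p by metis
      then have "r \<in> P" using prime_mult_notin[OF P, of r u] s u by blast
      moreover have "s * p = u * r" using s by (simp add: mult.commute)
      ultimately show ?thesis using s by blast
    next
      fix s r assume s: "s \<in> R" "s \<notin> M" "r \<in> R" "s * u = r * p"
      then have "s * u \<in> P" using submodule_mult[OF prime_submodule[OF P]] p by metis
      then show ?thesis using prime_mult_notin[OF P, of s u] s u True by blast
    qed
    have "\<exists>s\<in>R. s \<notin> M \<and> (\<exists>w\<in>frac_prod P P. s * z = u * w)" if "z \<in> frac_prod P P" for z
      using that
    proof (induction rule: frac_prod_induct)
      case (prod p q)
      then obtain s r where s: "s \<in> R" "s \<notin> M" "r \<in> P" "s * p = u * r" using divide by blast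
      then have "s * (p * q) = u * (r * q)" by (metis mult.assoc)
      then show ?case using s frac_prod_mult[OF s(3) prod(2)] by blast
    next
      case (sum z1 z2)
      then obtain s1 w1 s2 w2 where s: "s1 \<in> R" "s1 \<notin> M" "s1 * z1 = u * w1" "w1 \<in> frac_prod P P"
        "s2 \<in> R" "s2 \<notin> M" "s2 * z2 = u * w2" "w2 \<in> frac_prod P P" by blast
      have "s1 * s2 * (z1 + z2) = s2 * (s1 * z1) + s1 * (s2 * z2)" by (simp add: algebra_simps)
      also have "\<dots> = u * (s2 * w1 + s1 * w2)" by (simp add: s algebra_simps)
      finally have "s1 * s2 * (z1 + z2) = u * (s2 * w1 + s1 * w2)" .
      moreover have "s2 * w1 + s1 * w2 \<in> frac_prod P P"
        using s by (intro submodule_add[OF PP] submodule_mult[OF PP])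
      ultimately show ?case using s prime_mult_notin[OF M, of s1 s2] by blast
    qed
    then obtain s w where s: "s \<in> R" "s \<notin> M" "w \<in> frac_prod P P" "s * (u * x) = u * w"
      using u(3) by blast
    moreover have "u \<noteq> 0" using u submodule_zero[OF prime_submodule[OF P]] by blast
    ultimately have "s * x = w" by (simp add: algebra_simps)
    then show ?thesis using s by blast
  qed
qed

lemma strongly_discreteD:
  assumes "strongly_discrete R" "primeideal P (as_ring R)" "P \<noteq> {0}"
  obtains p where "p \<in> P" "p \<notin> frac_prod P P"
  using assms unfolding strongly_discrete_def ideal_prod_eq by blast

text \<open>
  If \<open>1 \<notin> J\<close>, the ideal \<open>J \<inter> R\<close> lies in a maximal ideal \<open>M\<close>.  In the valuation ring \<open>R\<^sub>M\<close> the module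
  \<open>J\<^sub>M\<close> is then comparable with every principal ideal \<open>x R\<^sub>M\<close>, hence contained in it when
  \<open>x \<notin> J\<^sub>M\<close>.  Consequently \<open>J\<^sub>M = J\<^sub>M J\<^sub>M \<subseteq> x J\<^sub>M\<close>, and \<open>x y \<in> J\<^sub>M\<close> forces
  \<open>y \<in> J\<^sub>M\<close>: the ideal is prime.  Its trace \<open>P\<close> on \<open>R\<close> inherits idempotency, at first only up to a factor
  outside \<open>M\<close>, which \<open>prime_square_cancel\<close> removes.
\<close>

lemma idempotent_one_mem:
  assumes B: "Bezout R" and sd: "strongly_discrete R"
    and J: "submodule J" "J \<noteq> {0}" and JJ: "frac_prod J J = J"
  shows "1 \<in> J"
proof (rule ccontr)
  assume "1 \<notin> J"
  moreover have "submodule (J \<inter> R)"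
    using J(1) submodule_R by (auto simp: submodule_def)
  ultimately obtain M where "maximalideal M (as_ring R)" and JM: "J \<inter> R \<subseteq> M"
    using exists_maximal[of "J \<inter> R"] by auto
  then have M: "primeideal M (as_ring R)" by (blast intro: maximal_prime)
  note notM = prime_mult_notin[OF M]
  define P where "P = {x \<in> R. \<exists>s\<in>R. s \<notin> M \<and> s * x \<in> J}"
  have PM: "P \<subseteq> M" using JM notM by (auto simp: P_def)
  have divide: "\<exists>t\<in>R. t \<notin> M \<and> t * j \<in> (*) x ` R" if j: "j \<in> J" and x: "x \<in> R" "x \<notin> P" for j x
  proof (rule locally_comparable[OF B M, of j x])
    fix s r assume s: "s \<in> R" "s \<notin> M" "r \<in> R" "s * j = r * x"
    then have "s * j \<in> (*) x ` R" by (auto intro!: image_eqI[of _ _ r] simp: mult.commute)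
    then show ?thesis using s by blast
  next
    fix s r assume s: "s \<in> R" "s \<notin> M" "r \<in> R" "s * x = r * j"
    then have "s * x \<in> J" using submodule_mult[OF J(1)] j by simp
    then show ?thesis using s x by (auto simp: P_def)
  qed
  have one: "1 \<notin> P" using PM prime_one_notin[OF M] by blast
  \<comment> \<open>Taking \<open>x = 1\<close> above shows that \<open>J\<close> is contained in \<open>R\<^sub>M\<close>.\<close>
  have integral: "\<exists>t\<in>R. t \<notin> M \<and> t * j \<in> P" if "j \<in> J" for j
  proof -
    obtain t where t: "t \<in> R" "t \<notin> M" "t * j \<in> R" using divide[OF \<open>j \<in> J\<close> _ one] by auto
    moreover have "1 * (t * j) \<in> J" using submodule_mult[OF J(1)] that t by simp
    ultimately show ?thesis using prime_one_notin[OF M] unfolding P_def by blast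
  qed
  have sP: "submodule P"
    unfolding submodule_def
  proof (intro conjI ballI)
    show "0 \<in> P" using submodule_zero[OF J(1)] prime_one_notin[OF M] by (auto simp: P_def)
    fix x assume "x \<in> P"
    then obtain s where s: "x \<in> R" "s \<in> R" "s \<notin> M" "s * x \<in> J" by (auto simp: P_def)
    show "x + y \<in> P" if "y \<in> P" for y
    proof -
      obtain t where t: "y \<in> R" "t \<in> R" "t \<notin> M" "t * y \<in> J" using \<open>y \<in> P\<close> by (auto simp: P_def)
      have "s * t * (x + y) \<in> J"
        by (rule submodule_add_scaled[OF J(1) s(2) t(2) s(4) t(4)])
      moreover have "s * t \<in> R" "s * t \<notin> M" "x + y \<in> R" using s t notM[of s t] by auto
      ultimately show ?thesis unfolding P_def by blast
    qed
    show "r * x \<in> P" if "r \<in> R" for r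
    proof -
      have "s * (r * x) \<in> J"
        using submodule_mult[OF J(1) that s(4)] by (simp add: mult.left_commute)
      then show ?thesis using s that by (auto simp: P_def)
    qed
  qed
  have P: "primeideal P (as_ring R)"
    unfolding primeideal_iff
  proof (intro conjI ballI impI)
    fix x y assume xy: "x \<in> R" "y \<in> R" "x * y \<in> P"
    show "x \<in> P \<or> y \<in> P"
    proof (rule ccontr)
      assume "\<not> (x \<in> P \<or> y \<in> P)"
      then have x: "x \<notin> P" and y: "y \<notin> P" by auto
      \<comment> \<open>One factor of each product \<open>j * k\<close> is locally divisible by \<open>x\<close>, the other stays in \<open>J\<close>.\<close>
      have "\<exists>t\<in>R. t \<notin> M \<and> t * z \<in> (*) x ` J" if "z \<in> frac_prod J J" for z
        using that
      proof (induction rule: frac_prod_induct)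
        case (prod j k)
        obtain t r where t: "t \<in> R" "t \<notin> M" "r \<in> R" "t * j = x * r"
          using divide[OF prod(1) xy(1) x] by blast
        then have "t * (j * k) = x * (r * k)" by (metis mult.assoc)
        then show ?case using t submodule_mult[OF J(1) t(3) prod(2)] by blast
      next
        case (sum z1 z2)
        then obtain t1 t2 where t: "t1 \<in> R" "t1 \<notin> M" "t1 * z1 \<in> (*) x ` J"
          "t2 \<in> R" "t2 \<notin> M" "t2 * z2 \<in> (*) x ` J" by blast
        note xJ = submodule_scale[OF J(1), of x]
        have "t1 * t2 * (z1 + z2) \<in> (*) x ` J"
          by (rule submodule_add_scaled[OF xJ t(1,4,3,6)])
        then show ?case using t notM[of t1 t2] by blast
      qed
      moreover obtain s where s: "s \<in> R" "s \<notin> M" "s * (x * y) \<in> J" using xy(3) by (auto simp: P_def)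
      ultimately obtain t j where t: "t \<in> R" "t \<notin> M" "j \<in> J" "t * (s * (x * y)) = x * j"
        using JJ by blast
      have "x \<noteq> 0" using x submodule_zero[OF sP] by blast
      then have "t * s * y = j" using t(4) by (simp add: algebra_simps)
      then have "y \<in> P" using t s xy notM[of t s] unfolding P_def by blast
      then show False using y by blast
    qed
  qed (use sP one in \<open>auto simp: P_def\<close>)
  have "P \<noteq> {0}"
  proof -
    obtain j where j: "j \<in> J" "j \<noteq> 0" using J submodule_zero by blast
    then obtain t where "t \<notin> M" "t * j \<in> P" using integral by blast
    then show ?thesis using j submodule_zero[OF prime_submodule[OF M]] by auto
  qed
  then obtain p where p: "p \<in> P" "p \<notin> frac_prod P P" using strongly_discreteD[OF sd P] by blast
  have "\<exists>t\<in>R. t \<notin> M \<and> t * z \<in> frac_prod P P" if "z \<in> frac_prod J J" for z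
    using that
  proof (induction rule: frac_prod_induct)
    case (prod j k)
    then obtain s t where s: "s \<in> R" "s \<notin> M" "s * j \<in> P" "t \<in> R" "t \<notin> M" "t * k \<in> P"
      using integral by meson
    have "s * t * (j * k) = (s * j) * (t * k)" by (simp add: algebra_simps)
    also have "\<dots> \<in> frac_prod P P" by (rule frac_prod_mult[OF s(3) s(6)])
    finally have "s * t * (j * k) \<in> frac_prod P P" .
    then show ?case using s notM[of s t] by blast
  next
    case (sum z1 z2)
    then obtain t1 t2 where t: "t1 \<in> R" "t1 \<notin> M" "t1 * z1 \<in> frac_prod P P"
      "t2 \<in> R" "t2 \<notin> M" "t2 * z2 \<in> frac_prod P P" by blast
    note PP = submodule_prod[OF sP sP]
    have "t1 * t2 * (z1 + z2) \<in> frac_prod P P"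
      by (rule submodule_add_scaled[OF PP t(1,4,3,6)])
    then show ?case using t notM[of t1 t2] by blast
  qed
  moreover obtain s where s: "s \<in> R" "s \<notin> M" "s * p \<in> J" using p by (auto simp: P_def)
  ultimately obtain t where t: "t \<in> R" "t \<notin> M" "t * (s * p) \<in> frac_prod P P" using JJ by blast
  have "t * s \<in> R" "t * s \<notin> P" using t s notM[of t s] PM by blast+
  moreover have "t * s * p \<in> frac_prod P P" using t(3) by (simp only: mult.assoc)
  ultimately have "p \<in> frac_prod P P" by (rule prime_square_cancel[OF B P p(1)])
  then show False using p by blast
qed

section \<open>Boole regular domains\<close>

lemma frac_prod_normalize:
  fixes c :: 'k
  assumes "c \<noteq> 0" "frac_prod I I = (*) c ` I"
  shows "frac_prod ((*) (inverse c) ` I) ((*) (inverse c) ` I) = (*) (inverse c) ` I"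
proof -
  have "inverse c * inverse c * (c * x) = inverse c * x" for x
    using assms(1) by (simp add: field_simps)
  then show ?thesis unfolding frac_prod_scale assms(2) image_image by (simp only:)
qed

text \<open>
  The determinant trick for two generators: \<open>z\<close> is an eigenvalue of a \<open>2 \<times> 2\<close> matrix over \<open>R\<close>, hence a
  root of its characteristic polynomial, which is monic.
\<close>

lemma pair_square_integral:
  assumes "integrally_closed R"
    and z: "p \<in> R" "q \<in> R" "r \<in> R" "s \<in> R" "z * u = p * u + q * v" "z * v = r * u + s * v"
    and uv: "u \<noteq> 0 \<or> v \<noteq> 0"
  shows "z \<in> R"
proof -
  define D where "D = (z - p) * (z - s) - q * r"
  have "D * u = (z - s) * (z * u - p * u) - q * (r * u)" by (simp add: D_def algebra_simps)
  also have "\<dots> = q * (z * v - s * v - r * u)" unfolding z(5) by (simp add: algebra_simps)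
  also have "\<dots> = 0" unfolding z(6) by simp
  finally have "D * u = 0" .
  moreover have "D * v = 0"
  proof -
    have "D * v = (z - p) * (z * v - s * v) - r * (q * v)" by (simp add: D_def algebra_simps)
    also have "\<dots> = r * (z * u - p * u - q * v)" unfolding z(6) by (simp add: algebra_simps)
    also have "\<dots> = 0" unfolding z(5) by simp
    finally show ?thesis .
  qed
  ultimately have "D = 0" using uv by auto
  then have "poly [:p * s - q * r, - (p + s), 1:] z = 0" by (simp add: D_def algebra_simps)
  moreover have "Polynomial.coeff [:p * s - q * r, - (p + s), 1:] i \<in> R" for i
  proof -
    have "p * s - q * r \<in> R" "- (p + s) \<in> R" using z by auto
    then show ?thesis by (auto simp: coeff_pCons split: nat.split)
  qed
  ultimately have "integral_over R z"
    unfolding integral_over_def by (intro exI[of _ "[:p * s - q * r, - (p + s), 1:]"]) simp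
  then show ?thesis using assms(1) by (simp add: integrally_closed_def)
qed

text \<open>
  For a two-generated ideal \<open>I\<close> with \<open>I I = c I\<close>, the idempotent module \<open>J = I / c\<close> is generated by
  \<open>u\<close> and \<open>v\<close>.  It is closed under multiplication, so each of its elements maps \<open>u\<close> and \<open>v\<close> to
  \<open>R\<close>-combinations of them and is integral.  Since \<open>J = J J\<close>, the generators are also
  combinations of themselves with coefficients in \<open>J\<close>; the determinant of that system vanishes, and
  expanding it exhibits \<open>1\<close> as an element of \<open>J\<close>.
\<close>

lemma Boole_regular_imp_Bezout:
  assumes ic: "integrally_closed R" and "Boole_regular R"
  shows "Bezout R"
proof (rule BezoutI)
  fix a b assume ab: "a \<in> R" "b \<in> R"
  show "\<exists>g\<in>R. a \<in> (*) g ` R \<and> b \<in> (*) g ` R \<and> (\<exists>\<alpha>\<in>R. \<exists>\<beta>\<in>R. g = \<alpha> * a + \<beta> * b)"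
  proof (cases "a = 0 \<and> b = 0")
    case True
    then show ?thesis by (intro bexI[of _ 0] conjI) auto
  next
    case False
    define I where "I = {m + r * b |m r. m \<in> (*) a ` R \<and> r \<in> R}"
    have I: "submodule I" "I \<subseteq> R"
      using submodule_adjoin[OF submodule_scale[OF submodule_R]] ab by (auto simp: I_def)
    have I_iff: "z \<in> I \<longleftrightarrow> (\<exists>\<alpha>\<in>R. \<exists>\<beta>\<in>R. z = \<alpha> * a + \<beta> * b)" for z
      unfolding I_def by (auto simp: mult.commute[of a])
    have "a = 1 * a + 0 * b" "b = 0 * a + 1 * b" by simp_all
    then have abI: "a \<in> I" "b \<in> I" unfolding I_iff using zero_mem one_mem by blast+
    then have "I \<in> nonzero_fractional_ideals R"
      using I False unfolding nonzero_fractional_ideals_def fractional_ideal_iff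
      by (auto intro!: bexI[of _ 1])
    then obtain c where c: "c \<noteq> 0" "frac_prod I I = (*) c ` I"
      using assms(2) Boole_regular_iff[OF domain_with_quot_field] by blast
    define J where "J = (*) (inverse c) ` I"
    define u where "u = inverse c * a"
    define v where "v = inverse c * b"
    have J: "submodule J" using submodule_scale[OF I(1)] by (simp add: J_def)
    have JJ: "frac_prod J J = J"
      unfolding J_def by (rule frac_prod_normalize[OF c])
    have uv: "u \<in> J" "v \<in> J" using abI unfolding J_def u_def v_def by blast+
    have uv0: "u \<noteq> 0 \<or> v \<noteq> 0" using False c by (simp add: u_def v_def)
    have J_pair: "\<exists>\<alpha>\<in>R. \<exists>\<beta>\<in>R. z = \<alpha> * u + \<beta> * v" if z: "z \<in> J" for z
    proof -
      obtain \<alpha> \<beta> where "\<alpha> \<in> R" "\<beta> \<in> R" "z = inverse c * (\<alpha> * a + \<beta> * b)"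
        using z unfolding J_def by (auto simp: I_iff)
      then show ?thesis
        by (intro bexI[of _ \<alpha>] bexI[of _ \<beta>]) (auto simp: u_def v_def algebra_simps)
    qed
    have mult: "y * z \<in> J" if "y \<in> J" "z \<in> J" for y z
      using frac_prod_mult[OF that] JJ by simp
    have JR: "J \<subseteq> R"
    proof
      fix z assume z: "z \<in> J"
      obtain p q where "p \<in> R" "q \<in> R" "z * u = p * u + q * v"
        using J_pair[OF mult[OF z uv(1)]] by blast
      moreover obtain r s where "r \<in> R" "s \<in> R" "z * v = r * u + s * v"
        using J_pair[OF mult[OF z uv(2)]] by blast
      ultimately show "z \<in> R" using pair_square_integral[OF ic] uv0 by blast
    qed
    have J_comb: "\<exists>p\<in>J. \<exists>q\<in>J. z = p * u + q * v" if "z \<in> J" for z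
    proof -
      have "z \<in> frac_prod J J" using that JJ by simp
      then show ?thesis
      proof (induction rule: frac_prod_induct)
        case (prod i j)
        then obtain \<alpha> \<beta> where k: "\<alpha> \<in> R" "\<beta> \<in> R" "j = \<alpha> * u + \<beta> * v" using J_pair by blast
        then have "i * j = (\<alpha> * i) * u + (\<beta> * i) * v" by (simp add: algebra_simps)
        then show ?case using submodule_mult[OF J _ prod(1)] k by blast
      next
        case (sum y z)
        then obtain p q p' q' where k: "p \<in> J" "q \<in> J" "y = p * u + q * v"
          "p' \<in> J" "q' \<in> J" "z = p' * u + q' * v" by blast
        then have "y + z = (p + p') * u + (q + q') * v" by (simp add: algebra_simps)
        then show ?case using k submodule_add[OF J] by blast
      qed
    qed
    obtain p q where p: "p \<in> J" "q \<in> J" "u = p * u + q * v" using J_comb[OF uv(1)] by blast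
    obtain r s where r: "r \<in> J" "s \<in> J" "v = r * u + s * v" using J_comb[OF uv(2)] by blast
    \<comment> \<open>The determinant of the homogeneous system satisfied by \<open>(u, v)\<close>, which is not zero.\<close>
    define D where "D = (1 - p) * (1 - s) - q * r"
    have u': "u - p * u = q * v" and v': "v - s * v = r * u"
      using p(3) r(3) by (simp_all add: algebra_simps)
    have "D * u = (1 - s) * (u - p * u) - q * (r * u)" by (simp add: D_def algebra_simps)
    also have "\<dots> = 0" unfolding u' v'[symmetric] by (simp add: algebra_simps)
    finally have "D * u = 0" .
    moreover have "D * v = (1 - p) * (v - s * v) - r * (q * v)" by (simp add: D_def algebra_simps)
    then have "D * v = 0" unfolding v' u'[symmetric] by (simp add: algebra_simps)
    ultimately have "D = 0" using uv0 by auto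
    then have "1 = p + (s + (q * r + - (p * s)))" by (simp add: D_def algebra_simps)
    also have "\<dots> \<in> J"
      using p r mult by (intro submodule_add[OF J] submodule_uminus[OF J])
    finally have "1 \<in> J" .
    then obtain y where "y \<in> I" "1 = inverse c * y" by (auto simp: J_def)
    then have "c \<in> I" using c(1) by (simp add: field_simps)
    moreover have "a = c * u" "b = c * v" using c(1) by (simp_all add: u_def v_def)
    ultimately show ?thesis using I uv JR I_iff[of c] by (intro bexI[of _ c]) blast+
  qed
qed

lemma Boole_regular_imp_strongly_stable:
  assumes B: "Bezout R" and sd: "strongly_discrete R" and "Boole_regular R"
  shows "strongly_stable R"
  unfolding strongly_stable_def
proof (intro allI impI, elim conjE)
  fix I assume "ideal I (as_ring R)" "I \<noteq> {0}"
  then have I: "submodule I" "I \<subseteq> R" "I \<noteq> {0}" by (simp_all add: ideal_iff)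
  then have "I \<in> nonzero_fractional_ideals R"
    unfolding nonzero_fractional_ideals_def fractional_ideal_iff by (auto intro!: bexI[of _ 1])
  then obtain c where c: "c \<noteq> 0" "frac_prod I I = (*) c ` I"
    using assms(3) Boole_regular_iff[OF domain_with_quot_field] by blast
  define J where "J = (*) (inverse c) ` I"
  have IJ: "I = (*) c ` J" using c(1) by (simp add: J_def image_image mult.assoc[symmetric])
  have "frac_prod J J = J"
    unfolding J_def by (rule frac_prod_normalize[OF c])
  moreover have "submodule J" using submodule_scale[OF I(1)] by (simp add: J_def)
  moreover have "J \<noteq> {0}" using IJ I(3) by auto
  ultimately have one: "1 \<in> J" and mult: "\<And>x y. x \<in> J \<Longrightarrow> y \<in> J \<Longrightarrow> x * y \<in> J"
    using idempotent_one_mem[OF B sd] frac_prod_mult[of _ J _ J] by auto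
  have "endo_ring I = J"
  proof (intro equalityI subsetI)
    fix x assume "x \<in> endo_ring I"
    moreover have "c \<in> I" using IJ one by (auto intro: image_eqI[of _ _ 1])
    ultimately have "x * c \<in> I" by (simp add: endo_ring_def)
    then show "x \<in> J" using IJ c(1) by (auto simp: mult.commute)
  next
    fix x assume x: "x \<in> J"
    have "x * y \<in> I" if "y \<in> I" for y
    proof -
      obtain j where "j \<in> J" "y = c * j" using \<open>y \<in> I\<close> IJ by blast
      then show ?thesis using mult[OF x] IJ by (auto simp: mult.left_commute)
    qed
    then show "x \<in> endo_ring I" by (simp add: endo_ring_def)
  qed
  then show "\<exists>c\<in>I. I = (*) c ` endo_ring I"
    using IJ one by (intro bexI[of _ c]) (auto intro: image_eqI[of _ _ 1])
qed

section \<open>Strongly stable domains\<close>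

text \<open>
  The endomorphism ring is a ring with \<open>1\<close>, so it equals its own square.
\<close>

lemma principal_endo_ring_square:
  assumes "submodule I" "I = (*) c ` endo_ring I"
  shows "frac_prod I I = (*) c ` I"
proof -
  have "frac_prod (endo_ring I) (endo_ring I) = endo_ring I"
  proof (intro equalityI subsetI)
    fix x assume "x \<in> frac_prod (endo_ring I) (endo_ring I)"
    then show "x \<in> endo_ring I"
    proof (induction rule: frac_prod_induct)
      case (prod i j)
      then show ?case by (auto simp: endo_ring_def mult.assoc)
    next
      case (sum x y)
      then show ?case
        using submodule_add[OF assms(1)] by (auto simp: endo_ring_def distrib_right)
    qed
  next
    fix x assume "x \<in> endo_ring I"
    moreover have "1 \<in> endo_ring I" by (simp add: endo_ring_def)
    ultimately show "x \<in> frac_prod (endo_ring I) (endo_ring I)"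
      using frac_prod_mult[of x "endo_ring I" 1 "endo_ring I"] by simp
  qed
  then have "frac_prod ((*) c ` endo_ring I) ((*) c ` endo_ring I) = (*) (c * c) ` endo_ring I"
    by (simp only: frac_prod_scale)
  also have "\<dots> = (*) c ` (*) c ` endo_ring I" by (simp add: image_image mult.assoc)
  finally show ?thesis using assms(2) by simp
qed

lemma strongly_stableD:
  assumes "strongly_stable R" "submodule I" "I \<subseteq> R" "I \<noteq> {0}"
  obtains c where "c \<in> I" "c \<noteq> 0" "I = (*) c ` endo_ring I"
proof -
  obtain c where c: "c \<in> I" "I = (*) c ` endo_ring I"
    using assms unfolding strongly_stable_def ideal_iff by blast
  have "(*) 0 ` endo_ring I \<subseteq> {0}" by auto
  then have "c \<noteq> 0" using c(2) assms(4) submodule_zero[OF assms(2)] by auto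
  then show ?thesis using that c by blast
qed

lemma strongly_stable_imp_strongly_discrete:
  assumes "strongly_stable R" shows "strongly_discrete R"
  unfolding strongly_discrete_def ideal_prod_eq
proof (intro allI impI, elim conjE)
  fix P assume P: "primeideal P (as_ring R)" "P \<noteq> {0}"
  note sP = prime_submodule[OF P(1)]
  obtain c where c: "c \<in> P" "c \<noteq> 0" "P = (*) c ` endo_ring P"
    using strongly_stableD[OF assms sP prime_subset[OF P(1)] P(2)] .
  have "frac_prod P P \<subseteq> P"
    using sP prime_subset[OF P(1)] submodule_mult by (intro frac_prod_subset) auto
  moreover have "frac_prod P P \<noteq> P"
  proof
    assume "frac_prod P P = P"
    then have "c \<in> (*) c ` P" using principal_endo_ring_square[OF sP c(3)] c(1) by simp
    then have "1 \<in> P" using c(2) by auto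
    then show False using prime_one_notin[OF P(1)] by blast
  qed
  ultimately show "frac_prod P P \<subset> P" by blast
qed

lemma strongly_stable_imp_Boole_regular:
  assumes "strongly_stable R" shows "Boole_regular R"
  unfolding Boole_regular_iff[OF domain_with_quot_field]
proof
  fix I assume "I \<in> nonzero_fractional_ideals R"
  then obtain d where I: "submodule I" "I \<noteq> {0}" "d \<in> R" "d \<noteq> 0" "\<forall>x\<in>I. d * x \<in> R"
    unfolding nonzero_fractional_ideals_def fractional_ideal_iff by auto
  let ?J = "(*) d ` I"
  have J: "submodule ?J" "?J \<subseteq> R" using submodule_scale[OF I(1)] I(5) by auto
  have "?J \<noteq> {0}"
  proof -
    obtain x where "x \<in> I" "x \<noteq> 0" using I(1,2) submodule_zero by blast
    then have "d * x \<in> ?J" "d * x \<noteq> 0" using I(4) by auto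
    then show ?thesis by blast
  qed
  then obtain c where c: "c \<noteq> 0" "?J = (*) c ` endo_ring ?J"
    using strongly_stableD[OF assms J] by metis
  have "(*) (d * d) ` frac_prod I I = (*) c ` ?J"
    using principal_endo_ring_square[OF J(1) c(2)] by (simp only: frac_prod_scale)
  then have "(*) (inverse (d * d)) ` (*) (d * d) ` frac_prod I I = (*) (inverse (d * d)) ` (*) c ` ?J"
    by simp
  moreover have "inverse (d * d) * (d * d * x) = x" for x using I(4) by (simp add: field_simps)
  then have "(*) (inverse (d * d)) ` (*) (d * d) ` frac_prod I I = frac_prod I I"
    unfolding image_image by (simp only: image_ident)
  moreover have "inverse (d * d) * (c * (d * x)) = c / d * x" for x
    using I(4) by (simp add: field_simps)
  then have "(*) (inverse (d * d)) ` (*) c ` ?J = (*) (c / d) ` I"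
    unfolding image_image by (simp only:)
  ultimately have "frac_prod I I = (*) (c / d) ` I" by simp
  then show "\<exists>c. c \<noteq> 0 \<and> frac_prod I I = (*) c ` I" using c(1) I(4) by (intro exI[of _ "c / d"]) simp
qed

section \<open>Strong stability from finite character\<close>

text \<open>
  The conclusion says \<open>I I \<subseteq> a I\<close> in \<open>R\<^sub>M\<close>, that is, that \<open>I / a\<close> is there closed under
  multiplication; this form refers to \<open>I\<close> only and is preserved when \<open>a\<close> is replaced by a
  divisor of \<open>a\<close>.

  The elements \<open>r\<close> with \<open>r I\<^sub>M = I\<^sub>M\<close> form the complement of a prime ideal \<open>P\<close>.  For \<open>P = {0}\<close>
  every nonzero \<open>a \<in> I\<close> will do.  Otherwise strong discreteness yields \<open>p \<in> P\<close> outside \<open>P\<^sup>2\<close>; this \<open>p\<close>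
  generates \<open>P\<close> locally at \<open>P\<close>.  Any \<open>a \<in> I\<close> outside \<open>p I\<^sub>M\<close> then generates \<open>I\<^sub>M\<close> up to
  factors outside \<open>P\<close>: if \<open>a\<close> were a multiple \<open>a' g\<close> of some \<open>g \<in> I\<close> with \<open>a' \<in> P\<close>, it would lie in
  \<open>p I\<^sub>M\<close> after all.
\<close>

lemma locally_principal_square:
  assumes B: "Bezout R" and sd: "strongly_discrete R" and M: "primeideal M (as_ring R)"
    and I: "submodule I" "I \<subseteq> R" "I \<noteq> {0}"
  obtains a where "a \<in> I" "a \<noteq> 0"
    "\<And>y z. y \<in> I \<Longrightarrow> z \<in> I \<Longrightarrow> \<exists>s\<in>R. s \<notin> M \<and> s * (y * z) \<in> (*) a ` I"
proof -
  note notM = prime_mult_notin[OF M]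
  \<comment> \<open>\<open>stab r\<close> says \<open>r I = I\<close> in \<open>R\<^sub>M\<close>; for \<open>r \<in> R\<close> only \<open>I \<subseteq> r I\<close> has content.\<close>
  define stab where "stab r \<longleftrightarrow> (\<forall>y\<in>I. \<exists>s\<in>R. s \<notin> M \<and> (\<exists>w\<in>I. s * y = r * w))" for r
  have stab_mult: "stab (q * r)" if qr: "stab q" "stab r" for q r
    unfolding stab_def
  proof
    fix y assume "y \<in> I"
    then obtain s w where s: "s \<in> R" "s \<notin> M" "w \<in> I" "s * y = q * w"
      using qr(1) unfolding stab_def by blast
    then obtain t v where t: "t \<in> R" "t \<notin> M" "v \<in> I" "t * w = r * v"
      using qr(2) unfolding stab_def by blast
    have "t * s * y = q * (t * w)" using s(4) by (simp add: algebra_simps)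
    then have "t * s * y = q * r * v" using t(4) by (simp add: mult.assoc)
    then show "\<exists>s\<in>R. s \<notin> M \<and> (\<exists>w\<in>I. s * y = q * r * w)"
      using s t notM[of t s] by blast
  qed
  have stab_left: "stab q" if qr: "stab (q * r)" "r \<in> R" for q r
    unfolding stab_def
  proof
    fix y assume "y \<in> I"
    then obtain s w where s: "s \<in> R" "s \<notin> M" "w \<in> I" "s * y = q * (r * w)"
      using qr(1) unfolding stab_def mult.assoc by blast
    then show "\<exists>s\<in>R. s \<notin> M \<and> (\<exists>w\<in>I. s * y = q * w)"
      using submodule_mult[OF I(1) qr(2) s(3)] by blast
  qed
  obtain a\<^sub>0 where a\<^sub>0: "a\<^sub>0 \<in> I" "a\<^sub>0 \<noteq> 0" using I submodule_zero by blast
  have not_stab_zero: "\<not> stab 0"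
    using a\<^sub>0 submodule_zero[OF prime_submodule[OF M]] unfolding stab_def by auto
  have stab_unit: "stab s" if "s \<in> R" "s \<notin> M" for s
    using that unfolding stab_def by blast
  define P where "P = {r \<in> R. \<not> stab r}"
  have sP: "submodule P"
    unfolding submodule_def
  proof (intro conjI ballI)
    show "0 \<in> P" using not_stab_zero by (simp add: P_def)
    show "r * x \<in> P" if "r \<in> R" "x \<in> P" for r x
      using that stab_left[of x r] by (auto simp: P_def mult.commute)
    have add: "x + y \<in> P" if xy: "x \<in> P" "y \<in> P" and s: "s \<in> R" "s \<notin> M" "r \<in> R" "s * x = r * y"
      for x y s r
    proof -
      have "\<not> stab (x + y)"
      proof
        assume "stab (x + y)"
        then have "stab (s * (x + y))" by (rule stab_mult[OF stab_unit[OF s(1,2)]])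
        moreover have "s * (x + y) = y * (r + s)" using s(4) by (simp add: algebra_simps)
        ultimately have "stab y" using stab_left[of y "r + s"] s by auto
        then show False using xy by (simp add: P_def)
      qed
      then show ?thesis using xy by (auto simp: P_def)
    qed
    fix x y assume xy: "x \<in> P" "y \<in> P"
    show "x + y \<in> P"
    proof (rule locally_comparable[OF B M, of x y])
      fix s r assume "s \<in> R" "s \<notin> M" "r \<in> R" "s * x = r * y"
      then show ?thesis by (rule add[OF xy])
    next
      fix s r assume "s \<in> R" "s \<notin> M" "r \<in> R" "s * y = r * x"
      then have "y + x \<in> P" by (rule add[OF xy(2,1)])
      then show ?thesis by (simp add: add.commute)
    qed
  qed
  have P: "primeideal P (as_ring R)"
    using sP stab_mult stab_unit[of 1] prime_one_notin[OF M]
    by (auto simp: primeideal_iff P_def)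
  show ?thesis
  proof (cases "P = {0}")
    case True
    show ?thesis
    proof (rule that[OF a\<^sub>0])
      fix y z assume "y \<in> I" "z \<in> I"
      then have "y * z \<in> I" using I(1,2) submodule_mult by blast
      moreover have "stab a\<^sub>0" using True a\<^sub>0 I(2) by (auto simp: P_def)
      ultimately show "\<exists>s\<in>R. s \<notin> M \<and> s * (y * z) \<in> (*) a\<^sub>0 ` I"
        unfolding stab_def by (metis imageI)
    qed
  next
    case False
    then obtain p where p: "p \<in> P" "p \<notin> frac_prod P P" using strongly_discreteD[OF sd P] by blast
    have p0: "p \<noteq> 0" using p(2) submodule_zero[OF submodule_prod[OF sP sP]] by blast
    from p(1) obtain a where a: "a \<in> I" "\<And>s w. s \<in> R \<Longrightarrow> s \<notin> M \<Longrightarrow> w \<in> I \<Longrightarrow> s * a \<noteq> p * w"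
      unfolding P_def stab_def by blast
    have a0: "a \<noteq> 0"
      using a(2)[of 1 0] prime_one_notin[OF M] submodule_zero[OF I(1)] by auto
    have generates: "\<exists>u r. stab u \<and> r \<in> R \<and> u * y = a * r" if y: "y \<in> I" for y
    proof -
      have aR: "a \<in> R" and yR: "y \<in> R" using a(1) y I(2) by auto
      obtain g a' y' \<alpha> \<beta> where g: "g \<in> R" "a' \<in> R" "y' \<in> R" "\<alpha> \<in> R" "\<beta> \<in> R"
          "g \<noteq> 0" "a = g * a'" "y = g * y'" "g = \<alpha> * a + \<beta> * y" "\<alpha> * a' + \<beta> * y' = 1"
        by (rule Bezout_pair[OF B aR yR disjI1[OF a0]])
      have gI: "g \<in> I"
        unfolding g(9) using g(4,5) a(1) y I(1) by (intro submodule_add submodule_mult)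
      have "stab a'"
      proof (rule ccontr)
        assume "\<not> stab a'"
        then have a'P: "a' \<in> P" using g(2) by (simp add: P_def)
        have pR: "p \<in> R" using p by (simp add: P_def)
        obtain h p' b \<gamma> \<delta> where h: "h \<in> R" "p' \<in> R" "b \<in> R" "\<gamma> \<in> R" "\<delta> \<in> R"
            "h \<noteq> 0" "p = h * p'" "a' = h * b" "h = \<gamma> * p + \<delta> * a'" "\<gamma> * p' + \<delta> * b = 1"
          by (rule Bezout_pair[OF B pR g(2) disjI1[OF p0]])
        have hP: "h \<in> P"
          unfolding h(9) using h(4,5) p(1) a'P sP by (intro submodule_add submodule_mult)
        \<comment> \<open>Otherwise \<open>p = h * p'\<close> would be a product of two elements of \<open>P\<close>.\<close>
        have "stab p'"
        proof (rule ccontr)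
          assume "\<not> stab p'"
          then have "p' \<in> P" using h(2) by (simp add: P_def)
          then show False using frac_prod_mult[OF hP] p(2) h(7) by blast
        qed
        moreover have "b * g \<in> I" using submodule_mult[OF I(1) h(3) gI] .
        ultimately obtain s w where s: "s \<in> R" "s \<notin> M" "w \<in> I" "s * (b * g) = p' * w"
          unfolding stab_def by blast
        have "p' * (s * a) = h * p' * (s * (b * g))" unfolding g(7) h(8) by (simp add: algebra_simps)
        also have "\<dots> = p' * (p * w)" unfolding s(4) h(7) by (simp add: algebra_simps)
        finally have "s * a = p * w" using p0 h(7) by simp
        then show False using a(2) s by blast
      qed
      moreover have "a' * y = a * y'" using g(7,8) by (simp add: algebra_simps)
      ultimately show ?thesis using g(3) by blast
    qed
    show ?thesis
    proof (rule that[OF a(1) a0])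
      fix y z assume yz: "y \<in> I" "z \<in> I"
      obtain u r where u: "stab u" "r \<in> R" "u * y = a * r" using generates[OF yz(1)] by blast
      obtain s w where s: "s \<in> R" "s \<notin> M" "w \<in> I" "s * z = u * w"
        using u(1) yz(2) unfolding stab_def by blast
      have "s * (y * z) = y * (s * z)" by (simp add: mult.left_commute)
      also have "\<dots> = (u * y) * w" unfolding s(4) by (simp add: algebra_simps)
      also have "\<dots> = a * (r * w)" unfolding u(3) by (simp add: mult.assoc)
      finally show "\<exists>s\<in>R. s \<notin> M \<and> s * (y * z) \<in> (*) a ` I"
        using s submodule_mult[OF I(1) u(2) s(3)] by blast
    qed
  qed
qed

text \<open>
  Fix \<open>x \<noteq> 0\<close> in \<open>I\<close>.  At a maximal ideal \<open>M\<close> not containing \<open>x\<close> the inclusion \<open>I I \<subseteq> x I\<close> holds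
  trivially, \<open>x\<close> being a unit there; at each of the finitely many others
  \<open>locally_principal_square\<close> provides an element \<open>a M\<close>.  A common divisor \<open>d \<in> I\<close> of \<open>x\<close> and all the
  \<open>a M\<close> satisfies \<open>I I \<subseteq> d I\<close> at every \<open>M\<close>, hence globally, which means that \<open>I / d\<close> maps \<open>I\<close> into itself.
\<close>

lemma finite_character_imp_strongly_stable:
  assumes B: "Bezout R" and sd: "strongly_discrete R" and fc: "finite_character R"
  shows "strongly_stable R"
  unfolding strongly_stable_def
proof (intro allI impI, elim conjE)
  fix I assume "ideal I (as_ring R)" "I \<noteq> {0}"
  then have I: "submodule I" "I \<subseteq> R" "I \<noteq> {0}" by (simp_all add: ideal_iff)
  then obtain x where x: "x \<in> I" "x \<noteq> 0" using submodule_zero by blast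
  then have xR: "x \<in> R" using I by blast
  let ?Max = "{M. maximalideal M (as_ring R) \<and> (*) x ` R \<subseteq> M}"
  have "finite ?Max"
  proof (cases "(*) x ` R = R")
    \<comment> \<open>Finite character speaks of proper ideals only, so a unit \<open>x\<close> is treated apart.\<close>
    case True
    then have "?Max = {}"
      using maximal_prime prime_one_notin by fastforce
    then show ?thesis by (simp only: finite.emptyI)
  next
    case False
    have "x * 1 \<in> (*) x ` R" by (intro imageI) simp
    then have "(*) x ` R \<noteq> {0}" using x(2) by (metis mult.right_neutral singletonD)
    moreover have "ideal ((*) x ` R) (as_ring R)"
      using submodule_scale[OF submodule_R] xR by (auto simp: ideal_iff)
    ultimately show ?thesis using fc False unfolding finite_character_def by blast
  qed
  define Q where "Q M a \<longleftrightarrow> a \<in> I \<and>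
    (\<forall>y\<in>I. \<forall>z\<in>I. \<exists>s\<in>R. s \<notin> M \<and> s * (y * z) \<in> (*) a ` I)" for M a
  have "\<forall>M\<in>?Max. \<exists>a. Q M a"
  proof
    fix M assume "M \<in> ?Max"
    then have "primeideal M (as_ring R)" using maximal_prime by blast
    then show "\<exists>a. Q M a"
      unfolding Q_def by (rule locally_principal_square[OF B sd _ I]) blast
  qed
  from bchoice[OF this] obtain a where "\<forall>M\<in>?Max. Q M (a M)" ..
  then have a: "\<And>M. M \<in> ?Max \<Longrightarrow> a M \<in> I"
    "\<And>M y z. M \<in> ?Max \<Longrightarrow> y \<in> I \<Longrightarrow> z \<in> I \<Longrightarrow> \<exists>s\<in>R. s \<notin> M \<and> s * (y * z) \<in> (*) (a M) ` I"
    unfolding Q_def by blast+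
  have "finite (insert x (a ` ?Max))" "insert x (a ` ?Max) \<subseteq> I"
    using \<open>finite ?Max\<close> x a(1) by auto
  then obtain d where d: "d \<in> I" "insert x (a ` ?Max) \<subseteq> (*) d ` R"
    by (rule ideal_finite_divisor[OF B I(1,2)])
  have d0: "d \<noteq> 0" using d(2) x(2) by auto
  have dI: "b * z \<in> (*) d ` I" if b: "b \<in> (*) d ` R" and z: "z \<in> I" for b z
  proof -
    obtain r where r: "r \<in> R" "b = d * r" using b by blast
    then show ?thesis using submodule_mult[OF I(1) r(1) z] by (simp add: mult.assoc imageI)
  qed
  have square: "y * z \<in> (*) d ` I" if y: "y \<in> I" and z: "z \<in> I" for y z
  proof (rule local_global)
    show "submodule ((*) d ` I)" by (rule submodule_scale[OF I(1)])
    fix M assume M: "maximalideal M (as_ring R)"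
    show "\<exists>s\<in>R. s \<notin> M \<and> s * (y * z) \<in> (*) d ` I"
    proof (cases "x \<in> M")
      case False
      have "y * z \<in> I" using submodule_mult[OF I(1) _ z] y I(2) by blast
      then have "x * (y * z) \<in> (*) d ` I" using d(2) by (intro dI) auto
      then show ?thesis using xR False by blast
    next
      case True
      have sM: "submodule M" using M maximal_prime prime_submodule by blast
      have "x * r \<in> M" if "r \<in> R" for r
        using submodule_mult[OF sM that True] by (simp add: mult.commute)
      then have "M \<in> ?Max" using M by blast
      then obtain s w where s: "s \<in> R" "s \<notin> M" "w \<in> I" "s * (y * z) = a M * w"
        using a(2)[OF _ y z] by blast
      have "a M * w \<in> (*) d ` I" using d(2) \<open>M \<in> ?Max\<close> s(3) by (intro dI) auto
      then show ?thesis using s by metis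
    qed
  qed
  have "I = (*) d ` endo_ring I"
  proof (intro equalityI subsetI)
    fix y assume y: "y \<in> I"
    have "y / d * z \<in> I" if z: "z \<in> I" for z
    proof -
      obtain w where "w \<in> I" "y * z = d * w" using square[OF y z] by blast
      then show ?thesis using d0 by simp
    qed
    then have "y / d \<in> endo_ring I" by (simp add: endo_ring_def)
    moreover have "y = d * (y / d)" using d0 by simp
    ultimately show "y \<in> (*) d ` endo_ring I" by blast
  next
    fix y assume "y \<in> (*) d ` endo_ring I"
    then show "y \<in> I" using d(1) by (auto simp: endo_ring_def mult.commute)
  qed
  then show "\<exists>c\<in>I. I = (*) c ` endo_ring I" using d(1) by blast
qed

section \<open>Finite character from strong stability\<close>

definition comaximal :: "'k \<Rightarrow> 'k \<Rightarrow> bool"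
  where "comaximal a b \<longleftrightarrow> (\<exists>\<alpha>\<in>R. \<exists>\<beta>\<in>R. \<alpha> * a + \<beta> * b = 1)"

lemma comaximalI: "\<alpha> \<in> R \<Longrightarrow> \<beta> \<in> R \<Longrightarrow> \<alpha> * a + \<beta> * b = 1 \<Longrightarrow> comaximal a b"
  unfolding comaximal_def by blast

lemma comaximal_sym: "comaximal a b \<Longrightarrow> comaximal b a"
  unfolding comaximal_def by (metis add.commute)

lemma comaximal_one: "comaximal 1 a"
  by (rule comaximalI[of 1 0]) auto

lemma comaximal_mult:
  assumes "comaximal a c" "comaximal b c" "a \<in> R" "b \<in> R" "c \<in> R"
  shows "comaximal (a * b) c"
proof -
  obtain \<alpha> \<beta> where a: "\<alpha> \<in> R" "\<beta> \<in> R" "\<alpha> * a + \<beta> * c = 1"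
    using assms(1) unfolding comaximal_def by blast
  obtain \<gamma> \<delta> where b: "\<gamma> \<in> R" "\<delta> \<in> R" "\<gamma> * b + \<delta> * c = 1"
    using assms(2) unfolding comaximal_def by blast
  have "(\<alpha> * \<gamma>) * (a * b) + (\<alpha> * a * \<delta> + \<beta>) * c = \<alpha> * a * (\<gamma> * b + \<delta> * c) + \<beta> * c"
    by (simp add: algebra_simps)
  also have "\<dots> = 1" using a(3) b(3) by simp
  finally show ?thesis using a b assms(3-) by (intro comaximalI[of "\<alpha> * \<gamma>" "\<alpha> * a * \<delta> + \<beta>"]) auto
qed

lemma comaximal_divisor:
  assumes "comaximal a b" "b \<in> (*) c ` R" shows "comaximal a c"
proof -
  obtain \<alpha> \<beta> where a: "\<alpha> \<in> R" "\<beta> \<in> R" "\<alpha> * a + \<beta> * b = 1"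
    using assms(1) unfolding comaximal_def by blast
  obtain r where r: "r \<in> R" "b = c * r" using assms(2) by blast
  have "\<alpha> * a + (\<beta> * r) * c = 1" using a(3) r(2) by (simp add: algebra_simps)
  then show ?thesis using a r by (intro comaximalI[of \<alpha> "\<beta> * r"]) auto
qed

text \<open>
  Multiply a relation \<open>\<alpha> * a + \<beta> * b = 1\<close> by \<open>x\<close> and replace \<open>x\<close> by a multiple of \<open>b\<close> in the first
  summand and by a multiple of \<open>a\<close> in the second.
\<close>

lemma comaximal_mult_divides:
  assumes "comaximal a b" "x \<in> (*) a ` R" "x \<in> (*) b ` R"
  shows "x \<in> (*) (a * b) ` R"
proof -
  obtain \<alpha> \<beta> where a: "\<alpha> \<in> R" "\<beta> \<in> R" "\<alpha> * a + \<beta> * b = 1"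
    using assms(1) unfolding comaximal_def by blast
  obtain k l where k: "k \<in> R" "x = a * k" and l: "l \<in> R" "x = b * l" using assms(2,3) by blast
  have "x = \<alpha> * a * x + \<beta> * b * x" using a(3) by (metis distrib_right mult_1)
  also have "\<dots> = \<alpha> * a * (b * l) + \<beta> * b * (a * k)" using k(2) l(2) by simp
  also have "\<dots> = a * b * (\<alpha> * l + \<beta> * k)" by (simp add: algebra_simps)
  finally show ?thesis using a k l by (intro image_eqI[of _ _ "\<alpha> * l + \<beta> * k"]) auto
qed

lemma comaximal_not_common:
  assumes M: "primeideal M (as_ring R)" and ab: "comaximal a b" "a \<in> M"
  shows "b \<notin> M"
proof
  assume "b \<in> M"
  obtain \<alpha> \<beta> where c: "\<alpha> \<in> R" "\<beta> \<in> R" "\<alpha> * a + \<beta> * b = 1"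
    using ab(1) unfolding comaximal_def by blast
  have "\<alpha> * a + \<beta> * b \<in> M"
    using c(1,2) ab(2) \<open>b \<in> M\<close> prime_submodule[OF M] by (intro submodule_add submodule_mult)
  then show False using c(3) prime_one_notin[OF M] by simp
qed

lemma not_comaximal_common:
  assumes "\<not> comaximal a b" and ab: "a \<in> R" "b \<in> R"
  obtains M where "maximalideal M (as_ring R)" "a \<in> M" "b \<in> M"
proof -
  define I where "I = {m + r * b |m r. m \<in> (*) a ` R \<and> r \<in> R}"
  have I: "submodule I" "I \<subseteq> R"
    using submodule_adjoin[OF submodule_scale[OF submodule_R]] ab by (auto simp: I_def)
  have "a * 1 + 0 * b \<in> I" "a * 0 + 1 * b \<in> I" unfolding I_def by blast+
  then have "a \<in> I" "b \<in> I" by simp_all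
  moreover have "1 \<notin> I"
  proof
    assume "1 \<in> I"
    then obtain \<alpha> \<beta> where "\<alpha> \<in> R" "\<beta> \<in> R" "1 = a * \<alpha> + \<beta> * b" unfolding I_def by blast
    then show False using assms(1) comaximalI[of \<alpha> \<beta> a b] by (simp add: mult.commute)
  qed
  then obtain M where "maximalideal M (as_ring R)" "I \<subseteq> M" by (rule exists_maximal[OF I])
  ultimately show ?thesis using that[of M] by blast
qed

text \<open>
  The elements \<open>y n = x / (f 0 \<cdots> f (n - 1))\<close> generate an increasing chain of principal ideals, strictly
  increasing because \<open>y n = f n * y (Suc n)\<close>.  A maximal ideal contains at most one of the comaximal
  elements \<open>f k\<close>, so locally the chain becomes stationary and its union \<open>I\<close> is principal; this forces
  every endomorphism of \<open>I\<close> to lie in \<open>R\<close>.  A generator of \<open>I\<close> over \<open>R\<close> would lie in some member of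
  the chain and make the next \<open>f n\<close> a unit.
\<close>

lemma no_infinite_comaximal_divisors:
  assumes ss: "strongly_stable R" and x: "x \<in> R" "x \<noteq> 0"
    and f: "\<And>n. f n \<in> R" "\<And>n. x \<in> (*) (f n) ` R" "\<And>n. 1 \<notin> (*) (f n) ` R"
    and com: "\<And>i j. i \<noteq> j \<Longrightarrow> comaximal (f i) (f (j :: nat))"
  shows False
proof -
  define F where "F n = (\<Prod>i<n. f i)" for n
  have FR: "F n \<in> R" for n by (induction n) (use f(1) in \<open>auto simp: F_def\<close>)
  have Fcom: "comaximal (F n) (f k)" if "n \<le> k" for n k
    using that
  proof (induction n)
    case 0
    then show ?case by (simp add: F_def comaximal_one)
  next
    case (Suc n)
    then have "comaximal (F n * f n) (f k)"
      using com[of n k] FR f(1) by (intro comaximal_mult) auto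
    then show ?case by (simp add: F_def)
  qed
  have Fx: "x \<in> (*) (F n) ` R" for n
  proof (induction n)
    case 0
    then show ?case using x(1) by (simp add: F_def)
  next
    case (Suc n)
    then have "x \<in> (*) (F n * f n) ` R" using Fcom[of n n] f(2) by (intro comaximal_mult_divides) auto
    then show ?case by (simp add: F_def)
  qed
  define y where "y n = x / F n" for n
  have F0: "F n \<noteq> 0" for n using Fx[of n] x(2) by auto
  have yR: "y n \<in> R" for n using Fx[of n] F0[of n] by (auto simp: y_def)
  have y0: "y n \<noteq> 0" for n using F0 x(2) by (simp add: y_def)
  have ySuc: "y n = f n * y (Suc n)" for n
    using F0[of n] F0[of "Suc n"] by (simp add: y_def F_def field_simps)
  have step: "(*) (y n) ` R \<subseteq> (*) (y (Suc n)) ` R" for n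
  proof
    fix z assume "z \<in> (*) (y n) ` R"
    then obtain r where "r \<in> R" "z = y n * r" by blast
    then have "z = y (Suc n) * (f n * r)" "f n * r \<in> R" using ySuc[of n] f(1) by (auto simp: algebra_simps)
    then show "z \<in> (*) (y (Suc n)) ` R" by blast
  qed
  have mono: "(*) (y n) ` R \<subseteq> (*) (y k) ` R" if "n \<le> k" for n k
    using lift_Suc_mono_le[of "\<lambda>n. (*) (y n) ` R", OF step that] .
  define I where "I = (\<Union>n. (*) (y n) ` R)"
  have y_sub: "submodule ((*) (y n) ` R)" for n by (rule submodule_scale[OF submodule_R])
  have I: "submodule I"
    unfolding submodule_def
  proof (intro conjI ballI)
    show "0 \<in> I" using submodule_zero[OF y_sub] by (auto simp: I_def)
    fix u assume "u \<in> I"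
    then obtain m where m: "u \<in> (*) (y m) ` R" by (auto simp: I_def)
    show "r * u \<in> I" if "r \<in> R" for r using submodule_mult[OF y_sub that m] unfolding I_def by blast
    show "u + v \<in> I" if "v \<in> I" for v
    proof -
      obtain n where n: "v \<in> (*) (y n) ` R" using \<open>v \<in> I\<close> by (auto simp: I_def)
      have "u \<in> (*) (y (max m n)) ` R" "v \<in> (*) (y (max m n)) ` R"
        using m n mono[of m "max m n"] mono[of n "max m n"] by auto
      then show ?thesis using submodule_add[OF y_sub] unfolding I_def by blast
    qed
  qed
  have yI: "y n \<in> I" for n unfolding I_def by (rule UN_I[of n]) (auto intro: image_eqI[of _ _ 1])
  have "I \<subseteq> R" using yR by (auto simp: I_def)
  moreover have "I \<noteq> {0}" using yI[of 0] y0[of 0] by blast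
  ultimately obtain c where c: "c \<in> I" "c \<noteq> 0" "I = (*) c ` endo_ring I"
    using strongly_stableD[OF ss I] by blast
  have endo: "e \<in> R" if e: "e \<in> endo_ring I" for e
  proof (rule local_global[OF submodule_R])
    fix M assume "maximalideal M (as_ring R)"
    then have M: "primeideal M (as_ring R)" by (rule maximal_prime)
    obtain n where n: "\<And>k. k \<ge> n \<Longrightarrow> f k \<notin> M"
    proof (cases "\<exists>i. f i \<in> M")
      case True
      then obtain i where i: "f i \<in> M" by blast
      then have "f k \<notin> M" if "k \<ge> Suc i" for k
        using comaximal_not_common[OF M com[of i k] i] that by auto
      then show ?thesis using that by blast
    next
      case False
      then show ?thesis using that[of 0] by blast
    qed
    have local_unit: "\<exists>s\<in>R. s \<notin> M \<and> y n = s * y k" if "n \<le> k" for k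
      using that
    proof (induction k rule: dec_induct)
      case base
      show ?case using prime_one_notin[OF M] by (intro bexI[of _ 1]) auto
    next
      case (step k)
      then obtain s where s: "s \<in> R" "s \<notin> M" "y n = s * y k" by blast
      then have "y n = s * f k * y (Suc k)" using ySuc[of k] by (simp add: mult.assoc)
      moreover have "s * f k \<notin> M" using prime_mult_notin[OF M s(1) f(1) s(2)] n step.hyps by auto
      ultimately show ?case using s f(1) by blast
    qed
    have "e * y n \<in> I" using e yI by (simp add: endo_ring_def)
    then obtain m where "e * y n \<in> (*) (y m) ` R" by (auto simp: I_def)
    then have "e * y n \<in> (*) (y (max m n)) ` R" using mono[of m "max m n"] by auto
    then obtain r where r: "r \<in> R" "e * y n = y (max m n) * r" by blast
    obtain s where s: "s \<in> R" "s \<notin> M" "y n = s * y (max m n)"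
      using local_unit[of "max m n"] by auto
    have "y (max m n) * (s * e) = y (max m n) * r" using r(2) s(3) by (simp add: algebra_simps)
    then have "s * e = r" using y0 by simp
    then show "\<exists>s\<in>R. s \<notin> M \<and> s * e \<in> R" using r s by blast
  qed
  obtain n r where r: "r \<in> R" "c = y n * r" using c(1) unfolding I_def by blast
  obtain e where e: "e \<in> endo_ring I" "y (Suc n) = c * e" using yI[of "Suc n"] c(3) by blast
  have "y (Suc n) * 1 = y (Suc n) * (f n * (r * e))"
    using e(2) r(2) ySuc[of n] by (simp add: algebra_simps)
  then have "1 = f n * (r * e)" using y0[of "Suc n"] by (simp only: mult_cancel_left) simp
  then show False using f(3)[of n] r(1) endo[OF e(1)] by blast
qed

lemma maximal_distinct_comaximal:
  assumes M: "maximalideal M (as_ring R)" and N: "maximalideal N (as_ring R)" and "M \<noteq> N"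
  obtains m n where "m \<in> M" "n \<in> N" "m + n = 1"
proof -
  note pM = maximal_prime[OF M] and pN = maximal_prime[OF N]
  have "\<not> M \<subseteq> N"
  proof
    assume "M \<subseteq> N"
    then have "N = M \<or> N = R"
      using maximalideal.I_maximal[OF M, of N] prime_submodule[OF pN] prime_subset[OF pN]
      by (simp add: ideal_iff)
    then show False using assms(3) prime_one_notin[OF pN] by auto
  qed
  then obtain x where x: "x \<in> M" "x \<notin> N" by blast
  then obtain n r where "n \<in> N" "r \<in> R" "n + r * x = 1"
    using maximal_comaximal[OF N] prime_subset[OF pM] by blast
  then show ?thesis
    using that[of "r * x" n] submodule_mult[OF prime_submodule[OF pM]] x by (simp add: add.commute)
qed

definition nonunit_divisors :: "'k \<Rightarrow> 'k set"
  where "nonunit_divisors x = {d \<in> R. x \<in> (*) d ` R \<and> 1 \<notin> (*) d ` R}"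

lemma divides_trans: "a \<in> (*) b ` R \<Longrightarrow> b \<in> (*) c ` R \<Longrightarrow> a \<in> (*) c ` R"
  by (auto simp: mult.assoc)

lemma prime_multiple_mem:
  assumes "primeideal M (as_ring R)" "a \<in> M" "b \<in> (*) a ` R"
  shows "b \<in> M"
  using assms(2,3) submodule_mult[OF prime_submodule[OF assms(1)]] by (auto simp: mult.commute)

lemma prime_nonunit:
  assumes "primeideal M (as_ring R)" "a \<in> M" shows "1 \<notin> (*) a ` R"
  using prime_multiple_mem[OF assms] prime_one_notin[OF assms(1)] by blast

lemma nonunit_divisors_trans:
  "d \<in> nonunit_divisors x \<Longrightarrow> h \<in> nonunit_divisors d \<Longrightarrow> h \<in> nonunit_divisors x"
  unfolding nonunit_divisors_def using divides_trans by blast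

text \<open>
  Two such elements that belong to different maximal ideals are automatically comaximal.
\<close>

definition only_maximal :: "'k \<Rightarrow> 'k set \<Rightarrow> bool"
  where "only_maximal h M \<longleftrightarrow> maximalideal M (as_ring R) \<and> h \<in> M \<and>
    (\<forall>N. maximalideal N (as_ring R) \<and> h \<in> N \<longrightarrow> N = M)"

text \<open>
  Two maximal ideals containing \<open>d\<close> have elements \<open>m\<close> and \<open>n\<close> with \<open>m + n = 1\<close>; the greatest common divisors
  of \<open>d\<close> with \<open>m\<close> and with \<open>n\<close> stay in the respective ideals and are comaximal.
\<close>

lemma nonunit_divisor_split:
  assumes B: "Bezout R" and d: "d \<in> R" "1 \<notin> (*) d ` R" "\<And>M. \<not> only_maximal d M"
  obtains a b where "a \<in> nonunit_divisors d" "b \<in> nonunit_divisors d" "comaximal a b"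
proof -
  have "submodule ((*) d ` R)" "(*) d ` R \<subseteq> R"
    using submodule_scale[OF submodule_R] d(1) by auto
  then obtain M where M: "maximalideal M (as_ring R)" "(*) d ` R \<subseteq> M"
    using exists_maximal d(2) by blast
  have "d * 1 \<in> (*) d ` R" by (intro imageI) simp
  then have dM: "d \<in> M" using M(2) by auto
  then obtain N where N: "maximalideal N (as_ring R)" "d \<in> N" "M \<noteq> N"
    using d(3)[of M] M(1) unfolding only_maximal_def by blast
  then obtain m n where mn: "m \<in> M" "n \<in> N" "m + n = 1"
    using maximal_distinct_comaximal[OF M(1)] by blast
  note pM = maximal_prime[OF M(1)] and pN = maximal_prime[OF N(1)]
  obtain a where a: "a \<in> M" "{d, m} \<subseteq> (*) a ` R"
    using ideal_finite_divisor[OF B prime_submodule[OF pM] prime_subset[OF pM], of "{d, m}"] dM mn(1)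
    by auto
  obtain b where b: "b \<in> N" "{d, n} \<subseteq> (*) b ` R"
    using ideal_finite_divisor[OF B prime_submodule[OF pN] prime_subset[OF pN], of "{d, n}"] N(2) mn(2)
    by auto
  have "m \<in> (*) a ` R" "n \<in> (*) b ` R" using a(2) b(2) by auto
  then obtain \<alpha> \<beta> where "\<alpha> \<in> R" "m = a * \<alpha>" "\<beta> \<in> R" "n = b * \<beta>" by (elim imageE)
  then have "comaximal a b" using mn(3) by (intro comaximalI[of \<alpha> \<beta>]) (auto simp: mult.commute)
  moreover have "a \<in> nonunit_divisors d" "b \<in> nonunit_divisors d"
    using a b prime_nonunit[OF pM] prime_nonunit[OF pN] prime_subset[OF pM] prime_subset[OF pN]
    by (auto simp: nonunit_divisors_def)
  ultimately show ?thesis using that by blast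
qed

text \<open>
  Suppose first that some nonunit divisor of \<open>x\<close> has no nonunit divisor belonging to a single maximal
  ideal.  Then it and all its nonunit divisors can be split, and splitting repeatedly one of the two parts yields
  the sequence.  Otherwise every nonunit divisor of \<open>x\<close> has a nonunit divisor that belongs to only
  one maximal ideal; let \<open>G\<close> be the set of the maximal ideals that occur.  If \<open>G\<close> is infinite, choose
  one such divisor for each.  If \<open>G\<close> were finite, a further maximal ideal \<open>N\<close> containing \<open>x\<close> would have an
  element \<open>y\<close> avoiding all members of \<open>G\<close>, and the greatest common divisor of \<open>x\<close> and \<open>y\<close> would be a nonunit
  divisor of \<open>x\<close> outside all members of \<open>G\<close>, contradicting the choice of \<open>G\<close>.
\<close>

lemma infinite_comaximal_divisors:
  assumes B: "Bezout R" and x: "x \<in> R"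
    and inf: "infinite {M. maximalideal M (as_ring R) \<and> x \<in> M}"
  obtains f :: "nat \<Rightarrow> 'k"
    where "\<And>n. f n \<in> nonunit_divisors x" "\<And>i j. i \<noteq> j \<Longrightarrow> comaximal (f i) (f j)"
proof (cases "\<forall>d\<in>nonunit_divisors x. \<exists>h\<in>nonunit_divisors d. \<exists>M. only_maximal h M")
  case False
  then obtain d\<^sub>0 where d\<^sub>0: "d\<^sub>0 \<in> nonunit_divisors x"
    "\<And>h M. h \<in> nonunit_divisors d\<^sub>0 \<Longrightarrow> \<not> only_maximal h M" by blast
  define D where "D = nonunit_divisors d\<^sub>0"
  have "\<forall>d\<in>D. \<exists>p. fst p \<in> nonunit_divisors d \<and> snd p \<in> nonunit_divisors d \<and> comaximal (fst p) (snd p)"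
  proof
    fix d assume d: "d \<in> D"
    then have "d \<in> R" "1 \<notin> (*) d ` R" by (auto simp: D_def nonunit_divisors_def)
    moreover have "\<not> only_maximal d M" for M using d\<^sub>0(2) d by (simp add: D_def)
    ultimately obtain a b
      where "a \<in> nonunit_divisors d" "b \<in> nonunit_divisors d" "comaximal a b"
      by (rule nonunit_divisor_split[OF B])
    then show "\<exists>p. fst p \<in> nonunit_divisors d \<and> snd p \<in> nonunit_divisors d \<and> comaximal (fst p) (snd p)"
      by (intro exI[of _ "(a, b)"]) simp
  qed
  from bchoice[OF this] obtain g
    where g: "\<forall>d\<in>D. fst (g d) \<in> nonunit_divisors d \<and> snd (g d) \<in> nonunit_divisors d \<and>
      comaximal (fst (g d)) (snd (g d))" ..
  \<comment> \<open>The part \<open>fst\<close> of each splitting is kept, the part \<open>snd\<close> is split further.\<close>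
  define e where "e n = ((\<lambda>d. snd (g d)) ^^ n) d\<^sub>0" for n
  define f where "f n = fst (g (e n))" for n
  have eSuc: "e (Suc n) = snd (g (e n))" for n by (simp add: e_def)
  have eD: "e n \<in> D" for n
  proof (induction n)
    case 0
    have "d\<^sub>0 \<in> (*) d\<^sub>0 ` R" by (rule image_eqI[of _ _ 1]) auto
    then show ?case using d\<^sub>0(1) by (simp add: e_def D_def nonunit_divisors_def)
  next
    case (Suc n)
    then have "snd (g (e n)) \<in> nonunit_divisors (e n)" using g by blast
    then show ?case using Suc nonunit_divisors_trans unfolding eSuc D_def by blast
  qed
  have f_e: "f n \<in> nonunit_divisors (e n)" "e (Suc n) \<in> nonunit_divisors (e n)"
    "comaximal (f n) (e (Suc n))" for n
    using g eD[of n] by (auto simp: f_def eSuc)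
  have e_dvd: "e n \<in> (*) (e m) ` R" if "n \<le> m" for n m
    using that
  proof (induction m rule: dec_induct)
    case base
    show ?case by (rule image_eqI[of _ _ 1]) auto
  next
    case (step m)
    then show ?case using f_e(2)[of m] divides_trans unfolding nonunit_divisors_def by blast
  qed
  have less: "comaximal (f i) (f j)" if "i < j" for i j
  proof -
    have "e (Suc i) \<in> (*) (e j) ` R" using e_dvd[of "Suc i" j] that by simp
    moreover have "e j \<in> (*) (f j) ` R" using f_e(1)[of j] by (simp add: nonunit_divisors_def)
    ultimately show ?thesis using comaximal_divisor[OF f_e(3)] divides_trans by blast
  qed
  show ?thesis
  proof (rule that)
    show "f n \<in> nonunit_divisors x" for n
      using f_e(1)[of n] eD[of n] d\<^sub>0(1) nonunit_divisors_trans unfolding D_def by blast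
    show "comaximal (f i) (f j)" if "i \<noteq> j" for i j
      using less[of i j] less[of j i] comaximal_sym that by (cases "i < j") auto
  qed
next
  case True
  define G where "G = {M. \<exists>h\<in>nonunit_divisors x. only_maximal h M}"
  show ?thesis
  proof (cases "finite G")
    case False
    then obtain g :: "nat \<Rightarrow> 'k set" where g: "inj g" "range g \<subseteq> G"
      using infinite_countable_subset by blast
    then have "\<forall>n. \<exists>h\<in>nonunit_divisors x. only_maximal h (g n)" unfolding G_def by blast
    then obtain h where h: "\<And>n. h n \<in> nonunit_divisors x" "\<And>n. only_maximal (h n) (g n)" by metis
    show ?thesis
    proof (rule that)
      show "h n \<in> nonunit_divisors x" for n by (rule h(1))
      show "comaximal (h i) (h j)" if ij: "i \<noteq> j" for i j
      proof (rule ccontr)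
        assume "\<not> comaximal (h i) (h j)"
        moreover have "h i \<in> R" "h j \<in> R" using h(1) by (auto simp: nonunit_divisors_def)
        ultimately obtain M where "maximalideal M (as_ring R)" "h i \<in> M" "h j \<in> M"
          by (rule not_comaximal_common)
        then have "g i = g j" using h(2) unfolding only_maximal_def by metis
        then show False using g(1) ij by (simp add: inj_eq)
      qed
    qed
  next
    case finG: True
    then have "\<not> {M. maximalideal M (as_ring R) \<and> x \<in> M} \<subseteq> G"
      using inf finite_subset by blast
    then obtain N where N: "maximalideal N (as_ring R)" "x \<in> N" "N \<notin> G" by blast
    note pN = maximal_prime[OF N(1)]
    have "\<forall>M\<in>G. \<exists>m. m \<in> M \<and> 1 - m \<in> N"
    proof
      fix M assume "M \<in> G"
      then have "maximalideal M (as_ring R)" "M \<noteq> N" using N(3) by (auto simp: G_def only_maximal_def)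
      then obtain m n where "m \<in> M" "n \<in> N" "m + n = 1"
        using maximal_distinct_comaximal N(1) by blast
      moreover from this have "1 - m = n" by (simp add: algebra_simps)
      ultimately show "\<exists>m. m \<in> M \<and> 1 - m \<in> N" by auto
    qed
    from bchoice[OF this] obtain c where c: "\<forall>M\<in>G. c M \<in> M \<and> 1 - c M \<in> N" ..
    have pG: "primeideal M (as_ring R)" if "M \<in> G" for M
      using that maximal_prime by (auto simp: G_def only_maximal_def)
    have cR: "c M \<in> R" if "M \<in> G" for M using c prime_subset[OF pG[OF that]] that by blast
    \<comment> \<open>As in the Chinese remainder theorem, \<open>y\<close> is \<open>0\<close> modulo \<open>N\<close> and \<open>1\<close> modulo each member of \<open>G\<close>.\<close>
    define y where "y = 1 - (\<Prod>M\<in>G. c M)"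
    have prod: "(\<Prod>M\<in>H. c M) \<in> R \<and> 1 - (\<Prod>M\<in>H. c M) \<in> N" if "finite H" "H \<subseteq> G" for H
      using that
    proof (induction rule: finite_induct)
      case empty
      show ?case using submodule_zero[OF prime_submodule[OF pN]] by simp
    next
      case (insert M H)
      let ?p = "\<Prod>M\<in>H. c M"
      have IH: "?p \<in> R" "1 - ?p \<in> N" and M: "M \<in> G" using insert by auto
      have "1 - c M * ?p = (1 - c M) + c M * (1 - ?p)" by (simp add: algebra_simps)
      also have "\<dots> \<in> N"
        using c M cR[OF M] IH(2) prime_submodule[OF pN] by (intro submodule_add submodule_mult) auto
      finally show ?case using insert.hyps IH(1) cR[OF M] by auto
    qed
    have yN: "y \<in> N" using prod[OF finG] by (simp add: y_def)
    have y_notin: "y \<notin> M" if M: "M \<in> G" for M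
    proof
      assume "y \<in> M"
      have "(\<Prod>M\<in>G. c M) = (\<Prod>L\<in>G - {M}. c L) * c M"
        using prod.remove[OF finG M, of c] by (simp add: mult.commute)
      moreover have "(\<Prod>L\<in>G - {M}. c L) \<in> R" using prod[of "G - {M}"] finG by auto
      ultimately have "(\<Prod>M\<in>G. c M) \<in> M"
        using submodule_mult[OF prime_submodule[OF pG[OF M]]] c M by simp
      then have "y + (\<Prod>M\<in>G. c M) \<in> M"
        using submodule_add[OF prime_submodule[OF pG[OF M]] \<open>y \<in> M\<close>] by simp
      then show False using prime_one_notin[OF pG[OF M]] by (simp add: y_def)
    qed
    obtain d where d: "d \<in> N" "{x, y} \<subseteq> (*) d ` R"
      using ideal_finite_divisor[OF B prime_submodule[OF pN] prime_subset[OF pN], of "{x, y}"] N(2) yN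
      by auto
    have "d \<in> nonunit_divisors x"
      using d prime_subset[OF pN] prime_nonunit[OF pN d(1)] by (auto simp: nonunit_divisors_def)
    then obtain h M where h: "h \<in> nonunit_divisors d" "h \<in> nonunit_divisors x" "only_maximal h M"
      using True nonunit_divisors_trans by blast
    then have M: "M \<in> G" by (auto simp: G_def)
    have "h \<in> M" using h(3) by (simp add: only_maximal_def)
    moreover have "y \<in> (*) h ` R"
      using d(2) h(1) divides_trans by (auto simp: nonunit_divisors_def)
    ultimately have "y \<in> M" by (rule prime_multiple_mem[OF pG[OF M]])
    then show ?thesis using y_notin[OF M] by blast
  qed
qed

lemma strongly_stable_imp_finite_character:
  assumes "Bezout R" "strongly_stable R"
  shows "finite_character R"
  unfolding finite_character_def
proof (intro allI impI, elim conjE)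
  fix I assume I: "ideal I (as_ring R)" "I \<noteq> {0}"
  obtain x where x: "x \<in> I" "x \<noteq> 0" using I submodule_zero ideal_submodule by blast
  then have xR: "x \<in> R" using ideal_subset[OF I(1)] by blast
  have "finite {M. maximalideal M (as_ring R) \<and> x \<in> M}"
  proof (rule ccontr)
    assume "infinite {M. maximalideal M (as_ring R) \<and> x \<in> M}"
    then obtain f :: "nat \<Rightarrow> 'k"
      where f: "\<And>n. f n \<in> nonunit_divisors x" "\<And>i j. i \<noteq> j \<Longrightarrow> comaximal (f i) (f j)"
      by (rule infinite_comaximal_divisors[OF assms(1) xR]) blast
    have "f n \<in> R" "x \<in> (*) (f n) ` R" "1 \<notin> (*) (f n) ` R" for n
      using f(1)[of n] by (simp_all add: nonunit_divisors_def)
    then show False by (rule no_infinite_comaximal_divisors[OF assms(2) xR x(2) _ _ _ f(2)])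
  qed
  then show "finite {M. maximalideal M (as_ring R) \<and> I \<subseteq> M}"
    by (rule rev_finite_subset) (use x in blast)
qed

end

section \<open>The equivalence\<close>

theorem corollary2p12:
  fixes R :: "'k::field set"
  assumes "domain_with_quot_field R"
    and "integrally_closed R"
  shows "(strongly_discrete R \<and> Boole_regular R \<longleftrightarrow>
            strongly_discrete R \<and> Bezout R \<and> finite_character R) \<and>
         (strongly_discrete R \<and> Bezout R \<and> finite_character R \<longleftrightarrow> strongly_stable R)"
proof -
  interpret domain_in_field R by unfold_locales (rule assms(1))
  have "strongly_stable R" if "strongly_discrete R" "Boole_regular R"
    using Boole_regular_imp_strongly_stable Boole_regular_imp_Bezout[OF assms(2)] that by blast
  moreover have "strongly_discrete R \<and> Boole_regular R \<and> Bezout R \<and> finite_character R"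
    if "strongly_stable R"
    using that strongly_stable_imp_strongly_discrete strongly_stable_imp_Boole_regular
      Boole_regular_imp_Bezout[OF assms(2)] strongly_stable_imp_finite_character by blast
  ultimately show ?thesis using finite_character_imp_strongly_stable by blast
qed

end
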